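(* Let $A$ and $X$ be Banach algebras such that $X$ is an algebraic Banach $A$-module, and let $n\in\mathbb{N}\cup\{0\}$. Every derivation $D:A\bowtie X\to(A\bowtie X)^{(2n)}$ has the form $$D(a,x)=(D_A(a)+T_A(x),\,D_X(a)+T_X(x))\qquad(a\in A,\ x\in X),$$ where (a) $D_A:A\to A^{(2n)}$ and $D_X:A\to X^{(2n)}$ are derivations; (b) $T_A:X\to A^{(2n)}$ is a bounded $A$-module homomorphism satisfying $T_A(xy)=0$ for all $x,y\in X$; (c) $T_X:X\to X^{(2n)}$ is a bounded linear map such that $T_X(ax)=D_A(a)x+D_X(a)x+aT_X(x)$, $T_X(xa)=xD_A(a)+xD_X(a)+T_X(x)a$ and $T_X(xy)=xT_X(y)+T_X(x)y+xT_A(y)+T_A(x)y$ for all $a\in A$, $x,y\in X$. Moreover, $D=d_{(F,G)}$ for some $F\in A^{(2n)}$, $G\in X^{(2n)}$ if and only if $D_A=d_F$, $D_X=d_G$ and $T_X=d_G+\delta_F$ (are inner derivations), and $T_A=0$, where $\delta_F(x)=xF-Fx$ $(x\in X)$.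
   Context: Conventions. "Module" means two-sided module (bimodule). A derivation from a Banach algebra $B$ to a Banach $B$-module $E$ is a bounded linear map $D:B\to E$ with $D(bc)=D(b)c+bD(c)$; for $e\in E$, $d_e(b)=be-eb$ is the inner derivation implemented by $e$. For $G\in X^{(2n)}$, the symbol $d_G$ denotes the map $a\mapsto aG-Ga$ on $A$ when compared with $D_X$, and the map $x\mapsto xG-Gx$ on $X$ when compared with $T_X$. $E^{(m)}$ is the $m$-th dual of $E$, $E^{(0)}=E$. The dual $E^*$ of a Banach $B$-module is a Banach $B$-module via $\langle b\varphi,e\rangle=\langle\varphi,eb\rangle$, $\langle\varphi b,e\rangle=\langle\varphi,be\rangle$; iterating gives $E^{(m)}$ a $B$-module structure. For Banach algebras $A,X$ with $X$ a Banach $A$-module, $X$ is an algebraic Banach $A$-module if $a(xy)=(ax)y$, $(xy)a=x(ya)$, $(xa)y=x(ay)$, $\|ax\|\le\|a\|\|x\|$, $\|xa\|\le\|a\|\|x\|$ for all $a\in A$, $x,y\in X$. Then $A\bowtie X$ is the $\ell^1$-direct sum $A\times X$ with product $(a,x)(b,y)=(ab,ay+xb+xy)$, a Banach algebra. Identify $(A\bowtie X)^{(2n)}$ with $A^{(2n)}\times X^{(2n)}$. For $a\in A$, $x\in X$, $F\in A^{(2n)}$, $G\in X^{(2n)}$ its module operations are $(F,G)(a,x)=(Fa,Fx+Ga+Gx)$, $(a,x)(F,G)=(aF,xF+aG+xG)$, where $Fa,aF\in A^{(2n)}$ and $Fx,xF,Ga,aG,Gx,xG\in X^{(2n)}$.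 The products $xF,Fx\in X^{(2n)}$ are: for $n=0$ the module actions of $A$ on $X$; recursively, for $g\in X^{(2k+1)}$ let $xg,gx\in A^{(2k+1)}$ be $\langle xg,F\rangle=\langle g,Fx\rangle$, $\langle gx,F\rangle=\langle g,xF\rangle$ ($F\in A^{(2k)}$), and for $F\in A^{(2k+2)}$ let $\langle xF,g\rangle=\langle F,gx\rangle$, $\langle Fx,g\rangle=\langle F,xg\rangle$ ($g\in X^{(2k+1)}$). *)

theory Defs
  imports Complex_Main "HOL-Algebra.Module"
begin

section \<open>Normed spaces and Banach algebras with explicit carriers\<close>

text \<open>
  The m-th dual of a space cannot be a HOL type depending on the natural number m, so all
  levels of the tower of iterated duals of one space are carrier sets inside a single type.
  Normed spaces are therefore records, extending the \<open>module\<close> record of HOL-Algebra.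

  The scalar type is any complete real normed field; by the theorem of Mazur these are exactly
  the real and the complex numbers, so both readings of ``Banach algebra'' are covered.

  The field \<open>mult\<close> is the product of a Banach algebra; for a mere normed space it is irrelevant.
  The field \<open>one\<close> is never used (algebras need not be unital, so the \<open>ring\<close> and \<open>algebra\<close>
  locales of HOL-Algebra do not apply).
\<close>

record ('k, 'u) nspace = "('k, 'u) module" +
  nrm :: "'u \<Rightarrow> real"

definition scalar_ring :: "'k :: comm_ring_1 ring" where
  "scalar_ring = \<lparr>carrier = UNIV, monoid.mult = (*), one = 1, ring.zero = 0, add = (+)\<rparr>"

definition normed_space :: "('k :: {real_normed_field, banach}, 'u) nspace \<Rightarrow> bool" where
  "normed_space V \<longleftrightarrow>
     Module.module (scalar_ring :: 'k ring) V \<and>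
     (\<forall>x\<in>carrier V. 0 \<le> nrm V x \<and> (nrm V x = 0 \<longleftrightarrow> x = \<zero>\<^bsub>V\<^esub>)) \<and>
     (\<forall>c. \<forall>x\<in>carrier V. nrm V (c \<odot>\<^bsub>V\<^esub> x) = norm c * nrm V x) \<and>
     (\<forall>x\<in>carrier V. \<forall>y\<in>carrier V. nrm V (x \<oplus>\<^bsub>V\<^esub> y) \<le> nrm V x + nrm V y)"

definition banach_space :: "('k :: {real_normed_field, banach}, 'u) nspace \<Rightarrow> bool" where
  "banach_space V \<longleftrightarrow> normed_space V \<and>
     (\<forall>s :: nat \<Rightarrow> 'u. (\<forall>i. s i \<in> carrier V) \<longrightarrow>
        (\<forall>e>0. \<exists>N. \<forall>i\<ge>N. \<forall>j\<ge>N. nrm V (s i \<ominus>\<^bsub>V\<^esub> s j) < e) \<longrightarrow>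
        (\<exists>l\<in>carrier V. (\<lambda>i. nrm V (s i \<ominus>\<^bsub>V\<^esub> l)) \<longlonglongrightarrow> 0))"

definition linear_map ::
  "('k :: {real_normed_field, banach}, 'u) nspace \<Rightarrow> ('k, 'v) nspace \<Rightarrow> ('u \<Rightarrow> 'v) \<Rightarrow> bool" where
  "linear_map V W T \<longleftrightarrow>
     T \<in> carrier V \<rightarrow> carrier W \<and>
     (\<forall>x\<in>carrier V. \<forall>y\<in>carrier V. T (x \<oplus>\<^bsub>V\<^esub> y) = T x \<oplus>\<^bsub>W\<^esub> T y) \<and>
     (\<forall>c. \<forall>x\<in>carrier V. T (c \<odot>\<^bsub>V\<^esub> x) = c \<odot>\<^bsub>W\<^esub> T x)"

definition bounded_linear_map ::
  "('k :: {real_normed_field, banach}, 'u) nspace \<Rightarrow> ('k, 'v) nspace \<Rightarrow> ('u \<Rightarrow> 'v) \<Rightarrow> bool" where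
  "bounded_linear_map V W T \<longleftrightarrow> linear_map V W T \<and>
     (\<exists>K. \<forall>x\<in>carrier V. nrm W (T x) \<le> K * nrm V x)"

definition bounded_functional ::
  "('k :: {real_normed_field, banach}, 'u) nspace \<Rightarrow> ('u \<Rightarrow> 'k) \<Rightarrow> bool" where
  "bounded_functional V f \<longleftrightarrow>
     (\<forall>x\<in>carrier V. \<forall>y\<in>carrier V. f (x \<oplus>\<^bsub>V\<^esub> y) = f x + f y) \<and>
     (\<forall>c. \<forall>x\<in>carrier V. f (c \<odot>\<^bsub>V\<^esub> x) = c * f x) \<and>
     (\<exists>K. \<forall>x\<in>carrier V. norm (f x) \<le> K * nrm V x)"

definition banach_algebra :: "('k :: {real_normed_field, banach}, 'u) nspace \<Rightarrow> bool" where
  "banach_algebra B \<longleftrightarrow> banach_space B \<and>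
     (\<forall>a\<in>carrier B. linear_map B B (\<lambda>b. a \<otimes>\<^bsub>B\<^esub> b) \<and> linear_map B B (\<lambda>b. b \<otimes>\<^bsub>B\<^esub> a)) \<and>
     (\<forall>a\<in>carrier B. \<forall>b\<in>carrier B. \<forall>c\<in>carrier B.
        (a \<otimes>\<^bsub>B\<^esub> b) \<otimes>\<^bsub>B\<^esub> c = a \<otimes>\<^bsub>B\<^esub> (b \<otimes>\<^bsub>B\<^esub> c)) \<and>
     (\<forall>a\<in>carrier B. \<forall>b\<in>carrier B. nrm B (a \<otimes>\<^bsub>B\<^esub> b) \<le> nrm B a * nrm B b)"

text \<open>\<open>left M b e\<close> is \<open>b e\<close> and \<open>right M e b\<close> is \<open>e b\<close>.\<close>

record ('k, 'b, 'e) bimodule =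
  space :: "('k, 'e) nspace"
  left :: "'b \<Rightarrow> 'e \<Rightarrow> 'e"
  right :: "'e \<Rightarrow> 'b \<Rightarrow> 'e"

definition banach_bimodule ::
  "('k :: {real_normed_field, banach}, 'b) nspace \<Rightarrow> ('k, 'b, 'e) bimodule \<Rightarrow> bool" where
  "banach_bimodule B M \<longleftrightarrow> banach_algebra B \<and> banach_space (space M) \<and>
     (\<forall>b\<in>carrier B. linear_map (space M) (space M) (\<lambda>e. left M b e) \<and>
                    linear_map (space M) (space M) (\<lambda>e. right M e b)) \<and>
     (\<forall>e\<in>carrier (space M). linear_map B (space M) (\<lambda>b. left M b e) \<and>
                            linear_map B (space M) (\<lambda>b. right M e b)) \<and>
     (\<forall>b\<in>carrier B. \<forall>c\<in>carrier B. \<forall>e\<in>carrier (space M).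
        left M (b \<otimes>\<^bsub>B\<^esub> c) e = left M b (left M c e) \<and>
        right M e (b \<otimes>\<^bsub>B\<^esub> c) = right M (right M e b) c \<and>
        right M (left M b e) c = left M b (right M e c)) \<and>
     (\<exists>K. \<forall>b\<in>carrier B. \<forall>e\<in>carrier (space M).
        nrm (space M) (left M b e) \<le> K * nrm B b * nrm (space M) e \<and>
        nrm (space M) (right M e b) \<le> K * nrm B b * nrm (space M) e)"

definition regular_bimodule :: "('k, 'b) nspace \<Rightarrow> ('k, 'b, 'b) bimodule" where
  "regular_bimodule B = \<lparr>space = B, left = monoid.mult B, right = monoid.mult B\<rparr>"

text \<open>X carries two structures: \<open>X\<close> is the algebra, \<open>M\<close> is the same space as an A-module.\<close>

definition algebraic_banach_module ::
  "('k :: {real_normed_field, banach}, 'a) nspace \<Rightarrow> ('k, 'x) nspace \<Rightarrow>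
   ('k, 'a, 'x) bimodule \<Rightarrow> bool" where
  "algebraic_banach_module A X M \<longleftrightarrow>
     banach_algebra A \<and> banach_algebra X \<and> banach_bimodule A M \<and> space M = X \<and>
     (\<forall>a\<in>carrier A. \<forall>x\<in>carrier X. \<forall>y\<in>carrier X.
        left M a (x \<otimes>\<^bsub>X\<^esub> y) = left M a x \<otimes>\<^bsub>X\<^esub> y \<and>
        right M (x \<otimes>\<^bsub>X\<^esub> y) a = x \<otimes>\<^bsub>X\<^esub> right M y a \<and>
        right M x a \<otimes>\<^bsub>X\<^esub> y = x \<otimes>\<^bsub>X\<^esub> left M a y) \<and>
     (\<forall>a\<in>carrier A. \<forall>x\<in>carrier X.
        nrm X (left M a x) \<le> nrm A a * nrm X x \<and>
        nrm X (right M x a) \<le> nrm A a * nrm X x)"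

definition derivation ::
  "('k :: {real_normed_field, banach}, 'b) nspace \<Rightarrow> ('k, 'b, 'e) bimodule \<Rightarrow>
   ('b \<Rightarrow> 'e) \<Rightarrow> bool" where
  "derivation B M D \<longleftrightarrow> bounded_linear_map B (space M) D \<and>
     (\<forall>b\<in>carrier B. \<forall>c\<in>carrier B.
        D (b \<otimes>\<^bsub>B\<^esub> c) = right M (D b) c \<oplus>\<^bsub>space M\<^esub> left M b (D c))"

definition inner_derivation :: "('k, 'b, 'e) bimodule \<Rightarrow> 'e \<Rightarrow> 'b \<Rightarrow> 'e" where
  "inner_derivation M e b = left M b e \<ominus>\<^bsub>space M\<^esub> right M e b"

definition bounded_bimodule_hom ::
  "('k :: {real_normed_field, banach}, 'b) nspace \<Rightarrow> ('k, 'b, 'e) bimodule \<Rightarrow>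
   ('k, 'b, 'f) bimodule \<Rightarrow> ('e \<Rightarrow> 'f) \<Rightarrow> bool" where
  "bounded_bimodule_hom B M N T \<longleftrightarrow> bounded_linear_map (space M) (space N) T \<and>
     (\<forall>b\<in>carrier B. \<forall>e\<in>carrier (space M).
        T (left M b e) = left N b (T e) \<and> T (right M e b) = right N (T e) b)"


section \<open>Iterated duals\<close>

text \<open>
  \<open>W\<close> together with the pairing \<open>p\<close> is the dual of \<open>V\<close>: \<open>\<phi> \<mapsto> p \<phi>\<close> is a linear bijection from
  \<open>W\<close> onto the bounded linear functionals on \<open>V\<close> (as functions on the carrier of \<open>V\<close>), and the
  norm of \<open>W\<close> is the operator norm.
\<close>

definition is_dual ::
  "('k :: {real_normed_field, banach}, 'u) nspace \<Rightarrow> ('k, 'v) nspace \<Rightarrow>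
   ('v \<Rightarrow> 'u \<Rightarrow> 'k) \<Rightarrow> bool" where
  "is_dual V W p \<longleftrightarrow> normed_space W \<and>
     (\<forall>\<phi>\<in>carrier W. bounded_functional V (p \<phi>)) \<and>
     (\<forall>f. bounded_functional V f \<longrightarrow>
        (\<exists>!\<phi>. \<phi> \<in> carrier W \<and> (\<forall>e\<in>carrier V. p \<phi> e = f e))) \<and>
     (\<forall>\<phi>\<in>carrier W. \<forall>\<psi>\<in>carrier W. \<forall>e\<in>carrier V. p (\<phi> \<oplus>\<^bsub>W\<^esub> \<psi>) e = p \<phi> e + p \<psi> e) \<and>
     (\<forall>c. \<forall>\<phi>\<in>carrier W. \<forall>e\<in>carrier V. p (c \<odot>\<^bsub>W\<^esub> \<phi>) e = c * p \<phi> e) \<and>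
     (\<forall>\<phi>\<in>carrier W. nrm W \<phi> = (SUP e\<in>{e \<in> carrier V. nrm V e \<le> 1}. norm (p \<phi> e)))"

text \<open>
  \<open>level E k\<close> is the k-th dual of \<open>level E 0\<close>, and \<open>pair E k \<phi> e\<close> is the value of
  \<open>\<phi> \<in> level E (k + 1)\<close> at \<open>e \<in> level E k\<close>.  Only finitely many levels are constrained: for
  infinite-dimensional spaces no single type need be large enough to host all iterated duals,
  whereas for every m some type hosts the first m of them.
\<close>

record ('k, 'u) tower =
  level :: "nat \<Rightarrow> ('k, 'u) nspace"
  pair :: "nat \<Rightarrow> 'u \<Rightarrow> 'u \<Rightarrow> 'k"

definition dual_tower ::
  "nat \<Rightarrow> ('k :: {real_normed_field, banach}, 'u) nspace \<Rightarrow> ('k, 'u) tower \<Rightarrow> bool" where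
  "dual_tower m V E \<longleftrightarrow> level E 0 = V \<and>
     (\<forall>k<m. is_dual (level E k) (level E (Suc k)) (pair E k))"

text \<open>The adjoint of \<open>S : level E i \<rightarrow> level F j\<close>, mapping \<open>level F (j + 1)\<close> to \<open>level E (i + 1)\<close>.\<close>

definition adjoint_map ::
  "('k, 'u) tower \<Rightarrow> nat \<Rightarrow> ('k, 'v) tower \<Rightarrow> nat \<Rightarrow> ('u \<Rightarrow> 'v) \<Rightarrow> 'v \<Rightarrow> 'u" where
  "adjoint_map E i F j S \<psi> =
     (THE \<phi>. \<phi> \<in> carrier (level E (Suc i)) \<and>
        (\<forall>e\<in>carrier (level E i). pair E i \<phi> e = pair F j \<psi> (S e)))"

text \<open>
  The module actions on the k-th dual: \<open>\<langle>b\<phi>, e\<rangle> = \<langle>\<phi>, eb\<rangle>\<close> and \<open>\<langle>\<phi>b, e\<rangle> = \<langle>\<phi>, be\<rangle>\<close>.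
\<close>

fun lact :: "('k, 'e) tower \<Rightarrow> ('k, 'b, 'e) bimodule \<Rightarrow> nat \<Rightarrow> 'b \<Rightarrow> 'e \<Rightarrow> 'e"
  and ract :: "('k, 'e) tower \<Rightarrow> ('k, 'b, 'e) bimodule \<Rightarrow> nat \<Rightarrow> 'e \<Rightarrow> 'b \<Rightarrow> 'e"
where
  "lact E M 0 b \<phi> = left M b \<phi>"
| "lact E M (Suc k) b \<phi> = adjoint_map E k E k (\<lambda>e. ract E M k e b) \<phi>"
| "ract E M 0 \<phi> b = right M \<phi> b"
| "ract E M (Suc k) \<phi> b = adjoint_map E k E k (\<lambda>e. lact E M k b e) \<phi>"

definition dual_bimodule ::
  "('k, 'e) tower \<Rightarrow> ('k, 'b, 'e) bimodule \<Rightarrow> nat \<Rightarrow> ('k, 'b, 'e) bimodule" where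
  "dual_bimodule E M k = \<lparr>space = level E k, left = lact E M k, right = ract E M k\<rparr>"

text \<open>
  The mixed products, where P and Q are the towers of A and X.  For \<open>F\<close> in the 2k-th dual of A
  and \<open>g\<close> in the (2k+1)-st dual of X, \<open>mixl k x F\<close> and \<open>mixr k F x\<close> are \<open>xF\<close> and \<open>Fx\<close> in the
  2k-th dual of X, while \<open>mixl_odd k x g\<close> and \<open>mixr_odd k g x\<close> are \<open>xg\<close> and \<open>gx\<close> in the
  (2k+1)-st dual of A.
\<close>

fun mixl :: "('k, 'a) tower \<Rightarrow> ('k, 'x) tower \<Rightarrow> ('k, 'a, 'x) bimodule \<Rightarrow>
    nat \<Rightarrow> 'x \<Rightarrow> 'a \<Rightarrow> 'x"
  and mixr :: "('k, 'a) tower \<Rightarrow> ('k, 'x) tower \<Rightarrow> ('k, 'a, 'x) bimodule \<Rightarrow>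
    nat \<Rightarrow> 'a \<Rightarrow> 'x \<Rightarrow> 'x"
  and mixl_odd :: "('k, 'a) tower \<Rightarrow> ('k, 'x) tower \<Rightarrow> ('k, 'a, 'x) bimodule \<Rightarrow>
    nat \<Rightarrow> 'x \<Rightarrow> 'x \<Rightarrow> 'a"
  and mixr_odd :: "('k, 'a) tower \<Rightarrow> ('k, 'x) tower \<Rightarrow> ('k, 'a, 'x) bimodule \<Rightarrow>
    nat \<Rightarrow> 'x \<Rightarrow> 'x \<Rightarrow> 'a"
where
  "mixl P Q M 0 x F = right M x F"
| "mixr P Q M 0 F x = left M F x"
| "mixl_odd P Q M k x g = adjoint_map P (2*k) Q (2*k) (\<lambda>F. mixr P Q M k F x) g"
| "mixr_odd P Q M k g x = adjoint_map P (2*k) Q (2*k) (\<lambda>F. mixl P Q M k x F) g"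
| "mixl P Q M (Suc k) x F = adjoint_map Q (2*k+1) P (2*k+1) (\<lambda>g. mixr_odd P Q M k g x) F"
| "mixr P Q M (Suc k) F x = adjoint_map Q (2*k+1) P (2*k+1) (\<lambda>g. mixl_odd P Q M k x g) F"


section \<open>The algebra \<open>A \<bowtie> X\<close> and its iterated duals\<close>

definition prod_space ::
  "(real \<Rightarrow> real \<Rightarrow> real) \<Rightarrow> ('k, 'a) nspace \<Rightarrow> ('k, 'x) nspace \<Rightarrow> ('k, 'a \<times> 'x) nspace" where
  "prod_space N V W =
     \<lparr>carrier = carrier V \<times> carrier W,
      monoid.mult = undefined, one = undefined,
      ring.zero = (\<zero>\<^bsub>V\<^esub>, \<zero>\<^bsub>W\<^esub>),
      add = (\<lambda>(a, x) (b, y). (a \<oplus>\<^bsub>V\<^esub> b, x \<oplus>\<^bsub>W\<^esub> y)),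
      smult = (\<lambda>c (a, x). (c \<odot>\<^bsub>V\<^esub> a, c \<odot>\<^bsub>W\<^esub> x)),
      nrm = (\<lambda>(a, x). N (nrm V a) (nrm W x))\<rparr>"

definition bowtie ::
  "('k, 'a) nspace \<Rightarrow> ('k, 'x) nspace \<Rightarrow> ('k, 'a, 'x) bimodule \<Rightarrow> ('k, 'a \<times> 'x) nspace" where
  "bowtie A X M = (prod_space (+) A X)
     \<lparr>monoid.mult := (\<lambda>(a, x) (b, y).
        (a \<otimes>\<^bsub>A\<^esub> b, left M a y \<oplus>\<^bsub>X\<^esub> right M x b \<oplus>\<^bsub>X\<^esub> x \<otimes>\<^bsub>X\<^esub> y))\<rparr>"

text \<open>
  The m-th dual of \<open>A \<bowtie> X\<close>, identified with the product of the m-th duals of A and X via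
  \<open>\<langle>(f, g), (F, G)\<rangle> = \<langle>f, F\<rangle> + \<langle>g, G\<rangle>\<close>; the dual norms are alternately the maximum and the sum.
\<close>

definition bowtie_tower ::
  "('k :: plus, 'a) tower \<Rightarrow> ('k, 'x) tower \<Rightarrow> ('k, 'a, 'x) bimodule \<Rightarrow>
   ('k, 'a \<times> 'x) tower" where
  "bowtie_tower P Q M =
     \<lparr>level = (\<lambda>m. if m = 0 then bowtie (level P 0) (level Q 0) M
                   else prod_space (if even m then (+) else max) (level P m) (level Q m)),
      pair = (\<lambda>m (f, g) (F, G). pair P m f F + pair Q m g G)\<rparr>"

text \<open>
  The identification is legitimate: \<open>bowtie_tower\<close> is a tower of iterated duals of \<open>A \<bowtie> X\<close>, with
  the exact dual norms.
\<close>

lemma scalar_ring_cring: "cring (scalar_ring :: 'k :: field ring)"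
proof -
  have "\<exists>y. x + y = 0" for x :: 'k using add.right_inverse by blast
  thus ?thesis unfolding scalar_ring_def using add.right_inverse
    by unfold_locales (auto simp: algebra_simps Units_def)
qed

lemma prod_space_simps [simp]:
  "carrier (prod_space N V W) = carrier V \<times> carrier W"
  "\<zero>\<^bsub>prod_space N V W\<^esub> = (\<zero>\<^bsub>V\<^esub>, \<zero>\<^bsub>W\<^esub>)"
  "(a, x) \<oplus>\<^bsub>prod_space N V W\<^esub> (b, y) = (a \<oplus>\<^bsub>V\<^esub> b, x \<oplus>\<^bsub>W\<^esub> y)"
  "c \<odot>\<^bsub>prod_space N V W\<^esub> (a, x) = (c \<odot>\<^bsub>V\<^esub> a, c \<odot>\<^bsub>W\<^esub> x)"
  "nrm (prod_space N V W) (a, x) = N (nrm V a) (nrm W x)"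
  by (simp_all add: prod_space_def)

lemma scalar_ring_simps [simp]:
  "carrier scalar_ring = UNIV" "c \<oplus>\<^bsub>scalar_ring\<^esub> d = c + d"
  "c \<otimes>\<^bsub>scalar_ring\<^esub> d = c * d" "\<one>\<^bsub>scalar_ring\<^esub> = 1" "\<zero>\<^bsub>scalar_ring\<^esub> = 0"
  by (simp_all add: scalar_ring_def)

lemma normed_space_prod:
  fixes V :: "('k :: {real_normed_field, banach}, 'u) nspace" and W :: "('k, 'v) nspace"
  assumes V: "normed_space V" and W: "normed_space W" and N: "N = (+) \<or> N = max"
  shows "normed_space (prod_space N V W)"
proof -
  interpret V: module "scalar_ring :: 'k ring" V using V by (simp add: normed_space_def)
  interpret W: module "scalar_ring :: 'k ring" W using W by (simp add: normed_space_def)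
  let ?S = "prod_space N V W"
  have ag: "abelian_group ?S"
  proof (rule abelian_groupI)
    fix x assume "x \<in> carrier ?S"
    then obtain a b where x: "x = (a, b)" "a \<in> carrier V" "b \<in> carrier W" by auto
    show "\<exists>y\<in>carrier ?S. y \<oplus>\<^bsub>?S\<^esub> x = \<zero>\<^bsub>?S\<^esub>"
      by (rule bexI[of _ "(\<ominus>\<^bsub>V\<^esub> a, \<ominus>\<^bsub>W\<^esub> b)"]) (use x in \<open>auto simp: V.l_neg W.l_neg\<close>)
  qed (auto simp: V.a_ac W.a_ac)
  have m: "module (scalar_ring :: 'k ring) ?S"
    by (rule moduleI[OF scalar_ring_cring ag])
       (use V.smult_closed W.smult_closed V.smult_l_distr W.smult_l_distr V.smult_r_distr W.smult_r_distr
          V.smult_assoc1 W.smult_assoc1 V.smult_one W.smult_one in auto)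
  have nV: "0 \<le> nrm V x" "nrm V x = 0 \<longleftrightarrow> x = \<zero>\<^bsub>V\<^esub>" "nrm V (c \<odot>\<^bsub>V\<^esub> x) = norm c * nrm V x"
     "y \<in> carrier V \<Longrightarrow> nrm V (x \<oplus>\<^bsub>V\<^esub> y) \<le> nrm V x + nrm V y" if "x \<in> carrier V" for x y c
    using V that by (auto simp: normed_space_def)
  have nW: "0 \<le> nrm W x" "nrm W x = 0 \<longleftrightarrow> x = \<zero>\<^bsub>W\<^esub>" "nrm W (c \<odot>\<^bsub>W\<^esub> x) = norm c * nrm W x"
     "y \<in> carrier W \<Longrightarrow> nrm W (x \<oplus>\<^bsub>W\<^esub> y) \<le> nrm W x + nrm W y" if "x \<in> carrier W" for x y c
    using W that by (auto simp: normed_space_def)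
  show ?thesis unfolding normed_space_def
  proof (intro conjI ballI allI)
    fix x assume "x \<in> carrier ?S"
    then obtain a b where x: "x = (a, b)" "a \<in> carrier V" "b \<in> carrier W" by auto
    show "0 \<le> nrm ?S x" "(nrm ?S x = 0) = (x = \<zero>\<^bsub>?S\<^esub>)"
      using N x nV(1,2)[of a] nW(1,2)[of b] by (auto simp: max_def split: if_splits)
    show "nrm ?S (c \<odot>\<^bsub>?S\<^esub> x) = norm c * nrm ?S x" for c
      using N x by (auto simp: nV nW algebra_simps max_mult_distrib_left)
    fix y assume "y \<in> carrier ?S"
    then obtain a' b' where y: "y = (a', b')" "a' \<in> carrier V" "b' \<in> carrier W" by auto
    show "nrm ?S (x \<oplus>\<^bsub>?S\<^esub> y) \<le> nrm ?S x + nrm ?S y"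
      using N x y nV(4)[of a a'] nW(4)[of b b'] by auto
  qed (rule m)
qed

lemma is_dual_bound:
  fixes V :: "('k :: {real_normed_field, banach}, 'u) nspace"
  assumes V: "normed_space V" and d: "is_dual V W p" and f: "f \<in> carrier W"
  shows "bdd_above ((\<lambda>e. norm (p f e)) ` {e \<in> carrier V. nrm V e \<le> 1})"
    and "e \<in> carrier V \<Longrightarrow> norm (p f e) \<le> nrm W f * nrm V e"
    and "0 < \<epsilon> \<Longrightarrow> \<exists>e\<in>carrier V. nrm V e \<le> 1 \<and> norm (p f e) > nrm W f - \<epsilon> \<and> p f e = of_real (norm (p f e))"
    and "p f \<zero>\<^bsub>V\<^esub> = 0" "\<zero>\<^bsub>V\<^esub> \<in> carrier V" "nrm V \<zero>\<^bsub>V\<^esub> = 0"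
proof -
  interpret V: module "scalar_ring :: 'k ring" V using V by (simp add: normed_space_def)
  have bf: "bounded_functional V (p f)" using d f by (simp add: is_dual_def)
  have n: "nrm W f = (SUP e\<in>{e \<in> carrier V. nrm V e \<le> 1}. norm (p f e))"
    using d f by (simp add: is_dual_def)
  have nV: "0 \<le> nrm V x" "nrm V x = 0 \<longleftrightarrow> x = \<zero>\<^bsub>V\<^esub>" "nrm V (c \<odot>\<^bsub>V\<^esub> x) = norm c * nrm V x"
    if "x \<in> carrier V" for x c
    using V that by (auto simp: normed_space_def)
  show z: "\<zero>\<^bsub>V\<^esub> \<in> carrier V" "nrm V \<zero>\<^bsub>V\<^esub> = 0" using nV by auto
  have lin: "p f (c \<odot>\<^bsub>V\<^esub> x) = c * p f x" if "x \<in> carrier V" for c x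
    using bf that by (auto simp: bounded_functional_def)
  show "p f \<zero>\<^bsub>V\<^esub> = 0" using lin[of "\<zero>\<^bsub>V\<^esub>" 0] V.smult_l_null[of "\<zero>\<^bsub>V\<^esub>"] by simp
  then have p0: "p f \<zero>\<^bsub>V\<^esub> = 0" .
  obtain K where K: "\<And>x. x \<in> carrier V \<Longrightarrow> norm (p f x) \<le> K * nrm V x"
    using bf unfolding bounded_functional_def by blast
  show b: "bdd_above ((\<lambda>e. norm (p f e)) ` {e \<in> carrier V. nrm V e \<le> 1})"
  proof (rule bdd_aboveI2)
    fix e assume e: "e \<in> {e \<in> carrier V. nrm V e \<le> 1}"
    have "norm (p f e) \<le> K * nrm V e" using K e by simp
    also have "\<dots> \<le> \<bar>K\<bar> * nrm V e" using e nV by (intro mult_right_mono) auto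
    also have "\<dots> \<le> \<bar>K\<bar> * 1" using e nV by (intro mult_left_mono) auto
    finally show "norm (p f e) \<le> \<bar>K\<bar>" by simp
  qed
  show "norm (p f e) \<le> nrm W f * nrm V e" if e: "e \<in> carrier V"
  proof (cases "nrm V e = 0")
    case True
    then have "p f e = 0" using nV(2)[OF e] p0 by simp
    then show ?thesis by (simp add: True)
  next
    case False
    let ?c = "of_real (inverse (nrm V e)) :: 'k"
    have pos: "nrm V e > 0" using False nV e by (simp add: order_less_le)
    have "norm (p f (?c \<odot>\<^bsub>V\<^esub> e)) \<le> nrm W f" unfolding n
      by (rule cSUP_upper[OF _ b]) (use e V.smult_closed[of ?c e] pos in \<open>auto simp: nV norm_divide norm_inverse field_simps\<close>)
    then show ?thesis using pos e by (simp add: lin norm_mult norm_inverse norm_divide field_simps)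
  qed
  show "\<exists>e\<in>carrier V. nrm V e \<le> 1 \<and> norm (p f e) > nrm W f - \<epsilon> \<and> p f e = of_real (norm (p f e))" if "0 < \<epsilon>"
  proof -
    have "nrm W f - \<epsilon> < (SUP e\<in>{e \<in> carrier V. nrm V e \<le> 1}. norm (p f e))" using n that by simp
    then obtain e where e: "e \<in> carrier V" "nrm V e \<le> 1" "nrm W f - \<epsilon> < norm (p f e)"
      using less_cSUP_iff[OF _ b] z by fastforce
    define c :: 'k where "c = (if p f e = 0 then 1 else of_real (norm (p f e)) / p f e)"
    have "norm c = 1" "c * p f e = of_real (norm (p f e))" by (auto simp: c_def norm_divide)
    then show ?thesis using e V.smult_closed[of c e]
      by (intro bexI[of _ "c \<odot>\<^bsub>V\<^esub> e"]) (auto simp: nV lin)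
  qed
qed

lemma is_dual_prod:
  fixes V :: "('k :: {real_normed_field, banach}, 'u) nspace" and W :: "('k, 'v) nspace"
  assumes V: "normed_space V" and W: "normed_space W"
    and dV: "is_dual V V' p" and dW: "is_dual W W' q"
    and N: "N = (+) \<and> N' = max \<or> N = max \<and> N' = (+)"
  shows "is_dual (prod_space N V W) (prod_space N' V' W') (\<lambda>(f, g) (F, G). p f F + q g G)"
proof -
  interpret V: module "scalar_ring :: 'k ring" V using V by (simp add: normed_space_def)
  interpret W: module "scalar_ring :: 'k ring" W using W by (simp add: normed_space_def)
  let ?S = "prod_space N V W" and ?S' = "prod_space N' V' W'"
    and ?p = "\<lambda>(f, g) (F, G). p f F + q g G"
  have V': "normed_space V'" and W': "normed_space W'" using dV dW by (auto simp: is_dual_def)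
  have nV: "0 \<le> nrm V x" if "x \<in> carrier V" for x using V that by (auto simp: normed_space_def)
  have nW: "0 \<le> nrm W x" if "x \<in> carrier W" for x using W that by (auto simp: normed_space_def)
  have nV': "0 \<le> nrm V' x" if "x \<in> carrier V'" for x using V' that by (auto simp: normed_space_def)
  have nW': "0 \<le> nrm W' x" if "x \<in> carrier W'" for x using W' that by (auto simp: normed_space_def)
  note bV = is_dual_bound[OF V dV] and bW = is_dual_bound[OF W dW]
  have fV: "bounded_functional V (p f)" if "f \<in> carrier V'" for f using dV that by (simp add: is_dual_def)
  have fW: "bounded_functional W (q g)" if "g \<in> carrier W'" for g using dW that by (simp add: is_dual_def)
  have NV: "a \<le> N a b" and NW: "b \<le> N a b" if "0 \<le> a" "0 \<le> b" for a b using N that by auto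
  show ?thesis unfolding is_dual_def
  proof (intro conjI ballI allI impI)
    show "normed_space ?S'" by (rule normed_space_prod[OF V' W']) (use N in auto)
  next
    fix \<phi> assume "\<phi> \<in> carrier ?S'"
    then obtain f g where \<phi>: "\<phi> = (f, g)" "f \<in> carrier V'" "g \<in> carrier W'" by auto
    have ub: "norm (p f F + q g G) \<le> nrm V' f * nrm V F + nrm W' g * nrm W G"
      if "F \<in> carrier V" "G \<in> carrier W" for F G
      using norm_triangle_ineq[of "p f F" "q g G"] bV(2)[OF \<phi>(2) that(1)] bW(2)[OF \<phi>(3) that(2)] by linarith
    show "bounded_functional ?S (?p \<phi>)" unfolding bounded_functional_def
    proof (intro conjI ballI allI exI)
      fix x assume "x \<in> carrier ?S"
      then obtain F G where x: "x = (F, G)" "F \<in> carrier V" "G \<in> carrier W" by auto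
      show "?p \<phi> (c \<odot>\<^bsub>?S\<^esub> x) = c * ?p \<phi> x" for c
        using x \<phi> fV[of f] fW[of g] by (simp add: bounded_functional_def algebra_simps)
      show "norm (?p \<phi> x) \<le> (nrm V' f + nrm W' g) * nrm ?S x"
      proof -
        have "nrm V' f * nrm V F \<le> nrm V' f * nrm ?S x" "nrm W' g * nrm W G \<le> nrm W' g * nrm ?S x"
          using x nV nW nV' nW' \<phi> NV NW by (auto intro!: mult_left_mono)
        then show ?thesis using ub[OF x(2,3)] x \<phi> by (simp add: algebra_simps)
      qed
      fix y assume "y \<in> carrier ?S"
      then obtain F' G' where y: "y = (F', G')" "F' \<in> carrier V" "G' \<in> carrier W" by auto
      show "?p \<phi> (x \<oplus>\<^bsub>?S\<^esub> y) = ?p \<phi> x + ?p \<phi> y" 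
        using x y \<phi> fV[of f] fW[of g] by (simp add: bounded_functional_def algebra_simps)
    qed
    let ?U = "{e \<in> carrier ?S. nrm ?S e \<le> 1}"
    have z: "(\<zero>\<^bsub>V\<^esub>, \<zero>\<^bsub>W\<^esub>) \<in> ?U" using N bV(6)[OF \<phi>(2)] bW(6)[OF \<phi>(3)] by auto
    have le: "norm (?p \<phi> e) \<le> nrm ?S' \<phi>" if eU: "e \<in> ?U" for e
    proof -
      obtain F G where e: "e = (F, G)" "F \<in> carrier V" "G \<in> carrier W" "N (nrm V F) (nrm W G) \<le> 1"
        using eU by (cases e) simp
      have a: "nrm V' f * nrm V F + nrm W' g * nrm W G \<le> N' (nrm V' f) (nrm W' g)"
      proof (cases "N = max")
        case True
        then have "nrm V F \<le> 1" "nrm W G \<le> 1" using e by auto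
        then have "nrm V' f * nrm V F \<le> nrm V' f * 1" "nrm W' g * nrm W G \<le> nrm W' g * 1"
          by (intro mult_left_mono; use \<phi> nV' nW' in auto)+
        moreover have "N' = (+) \<or> N = (+)" using N by auto
        moreover have "N \<noteq> (+)" using True by (metis add.right_neutral max.idem one_add_one one_neq_zero add_left_imp_eq)
        ultimately show ?thesis by auto
      next
        case False
        then have N1: "N = (+)" "N' = max" using N by auto
        let ?m = "max (nrm V' f) (nrm W' g)"
        have "nrm V' f * nrm V F \<le> ?m * nrm V F" "nrm W' g * nrm W G \<le> ?m * nrm W G"
          using e nV nW by (auto intro!: mult_right_mono)
        then have "nrm V' f * nrm V F + nrm W' g * nrm W G \<le> ?m * (nrm V F + nrm W G)"
          by (simp add: algebra_simps)
        also have "\<dots> \<le> ?m * 1" using N1 e nV'[OF \<phi>(2)] by (intro mult_left_mono) auto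
        finally show ?thesis using N1 by simp
      qed
      then show ?thesis using ub[OF e(2,3)] e(1) \<phi>(1) by simp
    qed
    have bd: "bdd_above ((\<lambda>e. norm (?p \<phi> e)) ` ?U)" using le by (intro bdd_aboveI2) auto
    show "nrm ?S' \<phi> = (SUP e\<in>?U. norm (?p \<phi> e))"
    proof (rule antisym)
      show "(SUP e\<in>?U. norm (?p \<phi> e)) \<le> nrm ?S' \<phi>"
        by (rule cSUP_least) (use z le in auto)
      show "nrm ?S' \<phi> \<le> (SUP e\<in>?U. norm (?p \<phi> e))" (is "_ \<le> ?s")
      proof (rule field_le_epsilon)
        fix \<epsilon> :: real assume \<epsilon>: "0 < \<epsilon>"
        obtain F where F: "F \<in> carrier V" "nrm V F \<le> 1" "norm (p f F) > nrm V' f - \<epsilon>/2"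
          "p f F = of_real (norm (p f F))" using bV(3)[OF \<phi>(2), of "\<epsilon>/2"] \<epsilon> by auto
        obtain G where G: "G \<in> carrier W" "nrm W G \<le> 1" "norm (q g G) > nrm W' g - \<epsilon>/2"
          "q g G = of_real (norm (q g G))" using bW(3)[OF \<phi>(3), of "\<epsilon>/2"] \<epsilon> by auto
        have up: "norm (p f a + q g b) \<le> ?s" if "(a, b) \<in> ?U" for a b
          using cSUP_upper[OF that bd] \<phi>(1) by simp
        show "nrm ?S' \<phi> \<le> ?s + \<epsilon>"
        proof (cases "N = (+)")
          case True
          have "N' = max" using N True by (metis add.right_neutral max.idem one_add_one one_neq_zero add_left_imp_eq)
          moreover have "norm (p f F) \<le> ?s" "norm (q g G) \<le> ?s"
            using up[of F "\<zero>\<^bsub>W\<^esub>"] up[of "\<zero>\<^bsub>V\<^esub>" G] True F G bV(4-6)[OF \<phi>(2)] bW(4-6)[OF \<phi>(3)] by auto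
          ultimately show ?thesis using F G \<epsilon> \<phi> by auto
        next
          case False
          then have N1: "N = max" "N' = (+)" using N by auto
          have "p f F + q g G = of_real (norm (p f F) + norm (q g G))" using F(4) G(4) by simp
          then have "norm (p f F + q g G) = norm (p f F) + norm (q g G)"
            by (metis abs_of_nonneg add_nonneg_nonneg norm_ge_zero norm_of_real)
          moreover have "norm (p f F + q g G) \<le> ?s" using up[of F G] N1 F G by auto
          ultimately show ?thesis using F G \<phi> N1 by simp
        qed
      qed
    qed
    show "?p (c \<odot>\<^bsub>?S'\<^esub> \<phi>) e = c * ?p \<phi> e" if "e \<in> carrier ?S" for c e
      using that \<phi> dV dW by (auto simp: is_dual_def algebra_simps)
    show "?p (\<phi> \<oplus>\<^bsub>?S'\<^esub> \<psi>) e = ?p \<phi> e + ?p \<psi> e" if "\<psi> \<in> carrier ?S'" "e \<in> carrier ?S" for \<psi> e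
      using that \<phi> dV dW by (auto simp: is_dual_def algebra_simps)
  next
    fix h assume h: "bounded_functional ?S h"
    obtain K where K: "\<And>x. x \<in> carrier ?S \<Longrightarrow> norm (h x) \<le> K * nrm ?S x"
      using h unfolding bounded_functional_def by blast
    have zV: "\<zero>\<^bsub>V\<^esub> \<in> carrier V" "nrm V \<zero>\<^bsub>V\<^esub> = 0" and zW: "\<zero>\<^bsub>W\<^esub> \<in> carrier W" "nrm W \<zero>\<^bsub>W\<^esub> = 0" 
      using V W by (auto simp: normed_space_def)
    have hadd: "h (a \<oplus>\<^bsub>V\<^esub> b, x \<oplus>\<^bsub>W\<^esub> y) = h (a, x) + h (b, y)"
      if "a \<in> carrier V" "b \<in> carrier V" "x \<in> carrier W" "y \<in> carrier W" for a b x y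
      using h that unfolding bounded_functional_def by force
    have hsm: "h (c \<odot>\<^bsub>V\<^esub> a, c \<odot>\<^bsub>W\<^esub> x) = c * h (a, x)"
      if "a \<in> carrier V" "x \<in> carrier W" for a x c
      using h that unfolding bounded_functional_def by force
    have N0: "N a 0 = a" "N 0 a = a" if "0 \<le> a" for a using N that by auto
    have h1: "bounded_functional V (\<lambda>a. h (a, \<zero>\<^bsub>W\<^esub>))"
      unfolding bounded_functional_def
    proof (intro conjI ballI allI exI[of _ K])
      fix x y assume x: "x \<in> carrier V" and y: "y \<in> carrier V"
      show "h (x \<oplus>\<^bsub>V\<^esub> y, \<zero>\<^bsub>W\<^esub>) = h (x, \<zero>\<^bsub>W\<^esub>) + h (y, \<zero>\<^bsub>W\<^esub>)" using hadd[of x y "\<zero>\<^bsub>W\<^esub>" "\<zero>\<^bsub>W\<^esub>"] x y by simp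
    next
      fix c x assume x: "x \<in> carrier V"
      show "h (c \<odot>\<^bsub>V\<^esub> x, \<zero>\<^bsub>W\<^esub>) = c * h (x, \<zero>\<^bsub>W\<^esub>)" using hsm[of x "\<zero>\<^bsub>W\<^esub>" c] W.smult_r_null[of c] x by simp
    next
      fix x assume x: "x \<in> carrier V"
      show "norm (h (x, \<zero>\<^bsub>W\<^esub>)) \<le> K * nrm V x" using K[of "(x, \<zero>\<^bsub>W\<^esub>)"] x zW nV N0 by simp
    qed
    have h2: "bounded_functional W (\<lambda>a. h (\<zero>\<^bsub>V\<^esub>, a))"
      unfolding bounded_functional_def
    proof (intro conjI ballI allI exI[of _ K])
      fix x y assume x: "x \<in> carrier W" and y: "y \<in> carrier W"
      show "h (\<zero>\<^bsub>V\<^esub>, x \<oplus>\<^bsub>W\<^esub> y) = h (\<zero>\<^bsub>V\<^esub>, x) + h (\<zero>\<^bsub>V\<^esub>, y)" using hadd[of "\<zero>\<^bsub>V\<^esub>" "\<zero>\<^bsub>V\<^esub>" x y] x y by simp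
    next
      fix c x assume x: "x \<in> carrier W"
      show "h (\<zero>\<^bsub>V\<^esub>, c \<odot>\<^bsub>W\<^esub> x) = c * h (\<zero>\<^bsub>V\<^esub>, x)" using hsm[of "\<zero>\<^bsub>V\<^esub>" x c] V.smult_r_null[of c] x by simp
    next
      fix x assume x: "x \<in> carrier W"
      show "norm (h (\<zero>\<^bsub>V\<^esub>, x)) \<le> K * nrm W x" using K[of "(\<zero>\<^bsub>V\<^esub>, x)"] x zV nW N0 by simp
    qed
    have u1: "\<exists>!\<phi>. \<phi> \<in> carrier V' \<and> (\<forall>e\<in>carrier V. p \<phi> e = h (e, \<zero>\<^bsub>W\<^esub>))"
      using dV h1 by (simp add: is_dual_def)
    have u2: "\<exists>!\<phi>. \<phi> \<in> carrier W' \<and> (\<forall>e\<in>carrier W. q \<phi> e = h (\<zero>\<^bsub>V\<^esub>, e))"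
      using dW h2 by (simp add: is_dual_def)
    obtain f where f: "f \<in> carrier V'" "\<forall>e\<in>carrier V. p f e = h (e, \<zero>\<^bsub>W\<^esub>)" using u1 by blast
    obtain g where g: "g \<in> carrier W'" "\<forall>e\<in>carrier W. q g e = h (\<zero>\<^bsub>V\<^esub>, e)" using u2 by blast
    show "\<exists>!\<phi>. \<phi> \<in> carrier ?S' \<and> (\<forall>e\<in>carrier ?S. ?p \<phi> e = h e)"
    proof (rule ex1I[of _ "(f, g)"])
      show "(f, g) \<in> carrier ?S' \<and> (\<forall>e\<in>carrier ?S. ?p (f, g) e = h e)"
      proof (intro conjI ballI)
        fix e assume "e \<in> carrier ?S"
        then obtain a x where e: "e = (a, x)" "a \<in> carrier V" "x \<in> carrier W" by auto
        show "?p (f, g) e = h e" using hadd[of a "\<zero>\<^bsub>V\<^esub>" "\<zero>\<^bsub>W\<^esub>" x] e f g by simp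
      qed (use f g in auto)
    next
      fix \<phi> assume a: "\<phi> \<in> carrier ?S' \<and> (\<forall>e\<in>carrier ?S. ?p \<phi> e = h e)"
      then obtain f' g' where \<phi>: "\<phi> = (f', g')" "f' \<in> carrier V'" "g' \<in> carrier W'" by auto
      have "p f' e = h (e, \<zero>\<^bsub>W\<^esub>)" if "e \<in> carrier V" for e
        using a \<phi> that zW bW(4)[OF \<phi>(3)] by (metis (mono_tags, lifting) SigmaI add.right_neutral case_prod_conv prod_space_simps(1))
      moreover have "q g' e = h (\<zero>\<^bsub>V\<^esub>, e)" if "e \<in> carrier W" for e
        using a \<phi> that zV bV(4)[OF \<phi>(2)] by (metis (mono_tags, lifting) SigmaI add.left_neutral case_prod_conv prod_space_simps(1))
      ultimately have "f' = f" "g' = g" using u1 u2 f g \<phi> by blast+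
      then show "\<phi> = (f, g)" using \<phi> by simp
    qed
  qed
qed

lemma bowtie_simps [simp]:
  "carrier (bowtie A X M) = carrier (prod_space (+) A X)"
  "add (bowtie A X M) = add (prod_space (+) A X)"
  "smult (bowtie A X M) = smult (prod_space (+) A X)"
  "nrm (bowtie A X M) = nrm (prod_space (+) A X)"
  by (simp_all add: bowtie_def)

lemma dual_tower_bowtie_tower:
  fixes A :: "('k :: {real_normed_field, banach}, 'a) nspace" and X :: "('k, 'x) nspace"
  assumes "normed_space A" "normed_space X" "dual_tower m A P" "dual_tower m X Q"
  shows "dual_tower m (bowtie A X M) (bowtie_tower P Q M)"
proof -
  let ?T = "bowtie_tower P Q M"
  have P0: "level P 0 = A" and Q0: "level Q 0 = X" using assms by (auto simp: dual_tower_def)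
  have "is_dual (level ?T k) (level ?T (Suc k)) (pair ?T k)" if k: "k < m" for k
  proof -
    have n: "normed_space (level P k)" "normed_space (level Q k)"
      using assms k by (cases k; auto simp: dual_tower_def is_dual_def)+
    define N :: "real \<Rightarrow> real \<Rightarrow> real" where "N = (if even k then (+) else max)"
    define N' :: "real \<Rightarrow> real \<Rightarrow> real" where "N' = (if even k then max else (+))"
    have *: "is_dual (prod_space N (level P k) (level Q k)) (prod_space N' (level P (Suc k)) (level Q (Suc k)))
         (\<lambda>(f, g) (F, G). pair P k f F + pair Q k g G)"
      by (rule is_dual_prod) (use n assms k in \<open>auto simp: dual_tower_def N_def N'_def\<close>)
    have "level ?T (Suc k) = prod_space N' (level P (Suc k)) (level Q (Suc k))"
      by (simp add: bowtie_tower_def N'_def)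
    moreover have "pair ?T k = (\<lambda>(f, g) (F, G). pair P k f F + pair Q k g G)"
      by (simp add: bowtie_tower_def)
    moreover have "is_dual (level ?T k) W q = is_dual (prod_space N (level P k) (level Q k)) W q"
      for W :: "('k, 'a \<times> 'x) nspace" and q
      by (simp add: bowtie_tower_def is_dual_def bounded_functional_def N_def)
    ultimately show ?thesis using * by simp
  qed
  then show ?thesis using P0 Q0 by (simp add: dual_tower_def bowtie_tower_def)
qed

end

theory Submission
  imports Defs
begin

text \<open>
  Dualising twice, one shows by induction on \<open>k\<close> that on the \<open>2k\<close>-th dual the actions of \<open>(a, x)\<close>
  are \<open>(a, x)(F, G) = (aF, xF + aG + xG)\<close> and \<open>(F, G)(a, x) = (Fa, Fx + Ga + Gx)\<close>; on the odd duals
  in between the mixed term moves to the first component,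
  \<open>(a, x)(f, g) = (af + xg, ag + xg)\<close>.  The identity for \<open>D\<close>, applied to products of elements
  \<open>(a, 0)\<close> and \<open>(0, x)\<close>, then splits into the stated identities for the four components of \<open>D\<close>.
\<close>

section \<open>Normed spaces and adjoints\<close>

text \<open>\<open>adjoint_map\<close> is a definite description, so \<open>lact\<close>,
  \<open>ract\<close> and the mixed products say nothing beyond level 0 until the described
  functional is known to exist. Existence comes from boundedness of the map that is dualised, and
  the adjoint is then bounded again. Boundedness therefore has to climb the tower, and only with it
  do the pairing identities become usable. Elements of a dual are compared through their pairings
  with the level below. The mixed products link two different towers and reverse direction at each
  dualisation, which is why their even and odd forms are separate half steps. That \<open>TA\<close>
  vanishes on products and commutes with the actions of A has a single source: on an even dual, (0,
  x) acts with first component zero.\<close>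

lemma normed_space_abelian_group:
  fixes V :: "('k :: {real_normed_field, banach}, 'u) nspace"
  assumes "normed_space V"
  shows "abelian_group V"
proof -
  interpret module "scalar_ring :: 'k ring" V
    using assms by (simp add: normed_space_def)
  show ?thesis by (rule abelian_group_axioms)
qed

text \<open>Subtraction in a record goes through an additive inverse chosen by description. Restated
  as an addition, a difference in a product space can be computed componentwise.\<close>

lemma (in abelian_group) minus_eq_iff:
  assumes "x \<in> carrier G" "y \<in> carrier G" "z \<in> carrier G"
  shows "x \<ominus> y = z \<longleftrightarrow> x = z \<oplus> y"
proof
  assume "x \<ominus> y = z"
  then show "x = z \<oplus> y"
    using assms r_neg2[of y x] by (auto simp: minus_eq a_ac)
next
  assume "x = z \<oplus> y"
  then show "x \<ominus> y = z"
    using assms by (simp add: minus_eq a_assoc r_neg)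
qed

lemma linear_map_zero:
  fixes V :: "('k :: {real_normed_field, banach}, 'u) nspace"
  assumes "normed_space V" "normed_space W" "linear_map V W T"
  shows "T \<zero>\<^bsub>V\<^esub> = \<zero>\<^bsub>W\<^esub>"
proof -
  interpret V: module "scalar_ring :: 'k ring" V
    using assms by (simp add: normed_space_def)
  interpret W: module "scalar_ring :: 'k ring" W
    using assms by (simp add: normed_space_def)
  have T: "T \<zero>\<^bsub>V\<^esub> \<in> carrier W"
    using assms by (auto simp: linear_map_def)
  have "T (0 \<odot>\<^bsub>V\<^esub> \<zero>\<^bsub>V\<^esub>) = 0 \<odot>\<^bsub>W\<^esub> T \<zero>\<^bsub>V\<^esub>"
    using assms(3) V.zero_closed unfolding linear_map_def by blast
  then show ?thesis
    using V.smult_l_null[of "\<zero>\<^bsub>V\<^esub>"] W.smult_l_null[OF T] by simp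
qed

lemma bounded_linear_mapD:
  assumes "bounded_linear_map V W T"
  shows "x \<in> carrier V \<Longrightarrow> T x \<in> carrier W"
    and "x \<in> carrier V \<Longrightarrow> y \<in> carrier V \<Longrightarrow> T (x \<oplus>\<^bsub>V\<^esub> y) = T x \<oplus>\<^bsub>W\<^esub> T y"
    and "x \<in> carrier V \<Longrightarrow> T (c \<odot>\<^bsub>V\<^esub> x) = c \<odot>\<^bsub>W\<^esub> T x"
  using assms by (auto simp: bounded_linear_map_def linear_map_def)

text \<open>The constant in the definition may be negative. Nonnegativity of the norm on V allows
  the passage to its absolute value, as the operator norm estimate \<open>is_dual_nrm_le\<close>
  requires.\<close>

lemma bounded_linear_map_bound:
  assumes "normed_space V" "bounded_linear_map V W T"
  obtains K where "0 \<le> K" "\<And>x. x \<in> carrier V \<Longrightarrow> nrm W (T x) \<le> K * nrm V x"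
proof -
  obtain K where K: "\<And>x. x \<in> carrier V \<Longrightarrow> nrm W (T x) \<le> K * nrm V x"
    using assms(2) unfolding bounded_linear_map_def by blast
  have "nrm W (T x) \<le> \<bar>K\<bar> * nrm V x" if "x \<in> carrier V" for x
  proof -
    have "K * nrm V x \<le> \<bar>K\<bar> * nrm V x"
      using assms(1) that by (intro mult_right_mono) (auto simp: normed_space_def)
    then show ?thesis using K[OF that] by linarith
  qed
  then show thesis using that[of "\<bar>K\<bar>"] by simp
qed

text \<open>Both elements represent the bounded functional \<open>p \<psi>\<close>, and the dual
  contains only one such element.\<close>

lemma is_dual_eqI:
  assumes "is_dual V W p" "\<phi> \<in> carrier W" "\<psi> \<in> carrier W"
    and "\<And>e. e \<in> carrier V \<Longrightarrow> p \<phi> e = p \<psi> e"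
  shows "\<phi> = \<psi>"
proof -
  have "bounded_functional V (p \<psi>)"
    using assms by (simp add: is_dual_def)
  then have "\<exists>!\<chi>. \<chi> \<in> carrier W \<and> (\<forall>e\<in>carrier V. p \<chi> e = p \<psi> e)"
    using assms(1) unfolding is_dual_def by blast
  then show ?thesis using assms by blast
qed

lemma is_dual_pair_linear:
  assumes "is_dual V W p" "\<phi> \<in> carrier W" "e \<in> carrier V"
  shows "e' \<in> carrier V \<Longrightarrow> p \<phi> (e \<oplus>\<^bsub>V\<^esub> e') = p \<phi> e + p \<phi> e'"
    and "\<psi> \<in> carrier W \<Longrightarrow> p (\<phi> \<oplus>\<^bsub>W\<^esub> \<psi>) e = p \<phi> e + p \<psi> e"
    and "p (c \<odot>\<^bsub>W\<^esub> \<phi>) e = c * p \<phi> e"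
  using assms by (auto simp: is_dual_def bounded_functional_def)

lemma is_dual_pair_zero:
  fixes V :: "('k :: {real_normed_field, banach}, 'u) nspace"
  assumes "is_dual V W p" "e \<in> carrier V"
  shows "p \<zero>\<^bsub>W\<^esub> e = 0"
proof -
  interpret W: module "scalar_ring :: 'k ring" W
    using assms by (simp add: is_dual_def normed_space_def)
  show ?thesis
    using is_dual_pair_linear(3)[OF assms(1) _ assms(2), of "\<zero>\<^bsub>W\<^esub>" 0] W.smult_l_null[of "\<zero>\<^bsub>W\<^esub>"]
    by simp
qed

text \<open>A converse to the estimate by the operator norm: on the unit ball the bound
  \<open>C * nrm V e\<close> is at most C.\<close>

lemma is_dual_nrm_le:
  fixes V :: "('k :: {real_normed_field, banach}, 'u) nspace"
  assumes V: "normed_space V" and d: "is_dual V W p" and \<phi>: "\<phi> \<in> carrier W" and "0 \<le> C"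
    and C: "\<And>e. e \<in> carrier V \<Longrightarrow> norm (p \<phi> e) \<le> C * nrm V e"
  shows "nrm W \<phi> \<le> C"
proof -
  have "(SUP e\<in>{e \<in> carrier V. nrm V e \<le> 1}. norm (p \<phi> e)) \<le> C"
  proof (rule cSUP_least)
    \<comment> \<open>A real supremum is bounded above by C only over a nonempty index set; the zero
      vector lies in the ball.\<close>
    show "{e \<in> carrier V. nrm V e \<le> 1} \<noteq> {}"
      using is_dual_bound(5,6)[OF V d \<phi>] by force
    fix e assume e: "e \<in> {e \<in> carrier V. nrm V e \<le> 1}"
    then have "C * nrm V e \<le> C * 1"
      using \<open>0 \<le> C\<close> by (intro mult_left_mono) auto
    then show "norm (p \<phi> e) \<le> C"
      using C[of e] e by simp
  qed
  then show ?thesis using d \<phi> by (simp add: is_dual_def)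
qed

text \<open>An explicit candidate supplies existence in the description, and its pairings with the
  level below supply uniqueness. All later formulas for actions are verified in this way.\<close>

lemma adjoint_map_eqI:
  assumes "is_dual (level E i) (level E (Suc i)) (pair E i)" "\<phi> \<in> carrier (level E (Suc i))"
    and "\<And>e. e \<in> carrier (level E i) \<Longrightarrow> pair E i \<phi> e = pair F j \<psi> (S e)"
  shows "adjoint_map E i F j S \<psi> = \<phi>"
  unfolding adjoint_map_def
proof (rule the_equality)
  fix \<phi>' assume "\<phi>' \<in> carrier (level E (Suc i)) \<and>
    (\<forall>e\<in>carrier (level E i). pair E i \<phi>' e = pair F j \<psi> (S e))"
  then show "\<phi>' = \<phi>"
    using assms by (intro is_dual_eqI[OF assms(1)]) auto
qed (use assms in auto)

context
  fixes E :: "('k :: {real_normed_field, banach}, 'u) tower" and F :: "('k, 'v) tower"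
    and i j :: nat and S :: "'u \<Rightarrow> 'v"
  assumes nE: "normed_space (level E i)" and nF: "normed_space (level F j)"
    and dE: "is_dual (level E i) (level E (Suc i)) (pair E i)"
    and dF: "is_dual (level F j) (level F (Suc j)) (pair F j)"
    and S: "bounded_linear_map (level E i) (level F j) S"
begin

text \<open>The composite of \<psi> with S is a bounded functional, with constant the norm of \<psi>
  times a bound of S, so the dual contains an element that represents it.\<close>

lemma adjoint_map_pair:
  assumes \<psi>: "\<psi> \<in> carrier (level F (Suc j))"
  shows "adjoint_map E i F j S \<psi> \<in> carrier (level E (Suc i))"
    and "e \<in> carrier (level E i) \<Longrightarrow> pair E i (adjoint_map E i F j S \<psi>) e = pair F j \<psi> (S e)"
proof -
  note Sd = bounded_linear_mapD[OF S]
  obtain K where K: "\<And>x. x \<in> carrier (level E i) \<Longrightarrow> nrm (level F j) (S x) \<le> K * nrm (level E i) x"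
    using bounded_linear_map_bound[OF nE S] by blast
  have nn: "0 \<le> nrm (level F (Suc j)) \<psi>"
    using dF \<psi> by (auto simp: is_dual_def normed_space_def)
  have "bounded_functional (level E i) (\<lambda>e. pair F j \<psi> (S e))"
    unfolding bounded_functional_def
  proof (intro conjI ballI allI exI)
    show "norm (pair F j \<psi> (S x)) \<le> (nrm (level F (Suc j)) \<psi> * K) * nrm (level E i) x"
      if x: "x \<in> carrier (level E i)" for x
    proof -
      have "norm (pair F j \<psi> (S x)) \<le> nrm (level F (Suc j)) \<psi> * nrm (level F j) (S x)"
        by (rule is_dual_bound(2)[OF nF dF \<psi> Sd(1)[OF x]])
      also have "\<dots> \<le> nrm (level F (Suc j)) \<psi> * (K * nrm (level E i) x)"
        using K[OF x] nn by (rule mult_left_mono)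
      finally show ?thesis by (simp add: mult.assoc)
    qed
  qed (use dF \<psi> Sd in \<open>auto simp: is_dual_def bounded_functional_def\<close>)
  then obtain \<phi> where "\<phi> \<in> carrier (level E (Suc i))"
    "\<forall>e\<in>carrier (level E i). pair E i \<phi> e = pair F j \<psi> (S e)"
    using dE unfolding is_dual_def by blast
  moreover from this have "adjoint_map E i F j S \<psi> = \<phi>"
    by (intro adjoint_map_eqI[OF dE]) auto
  ultimately show "adjoint_map E i F j S \<psi> \<in> carrier (level E (Suc i))"
    and "e \<in> carrier (level E i) \<Longrightarrow> pair E i (adjoint_map E i F j S \<psi>) e = pair F j \<psi> (S e)"
    by auto
qed

text \<open>Linearity follows by comparing pairings, and the bound K of S serves for the adjoint
  too. This closes the induction along a tower: an adjoint can be dualised once more.\<close>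

lemma bounded_linear_adjoint_map:
  "bounded_linear_map (level F (Suc j)) (level E (Suc i)) (adjoint_map E i F j S)"
proof -
  let ?T = "adjoint_map E i F j S"
  interpret E': module "scalar_ring :: 'k ring" "level E (Suc i)"
    using dE by (simp add: is_dual_def normed_space_def)
  interpret F': module "scalar_ring :: 'k ring" "level F (Suc j)"
    using dF by (simp add: is_dual_def normed_space_def)
  note Sd = bounded_linear_mapD[OF S]
  obtain K where K: "0 \<le> K"
    "\<And>x. x \<in> carrier (level E i) \<Longrightarrow> nrm (level F j) (S x) \<le> K * nrm (level E i) x"
    using bounded_linear_map_bound[OF nE S] by blast
  show ?thesis
    unfolding bounded_linear_map_def linear_map_def
  proof (intro conjI ballI allI exI funcsetI)
    fix \<psi> assume \<psi>: "\<psi> \<in> carrier (level F (Suc j))"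
    show "?T \<psi> \<in> carrier (level E (Suc i))"
      by (rule adjoint_map_pair(1)[OF \<psi>])
    show "?T (c \<odot>\<^bsub>level F (Suc j)\<^esub> \<psi>) = c \<odot>\<^bsub>level E (Suc i)\<^esub> ?T \<psi>" for c
      by (rule adjoint_map_eqI[OF dE])
        (use \<psi> adjoint_map_pair[OF \<psi>] is_dual_pair_linear[OF dE] is_dual_pair_linear[OF dF] Sd in auto)
    show "?T (\<psi> \<oplus>\<^bsub>level F (Suc j)\<^esub> \<psi>') = ?T \<psi> \<oplus>\<^bsub>level E (Suc i)\<^esub> ?T \<psi>'"
      if \<psi>': "\<psi>' \<in> carrier (level F (Suc j))" for \<psi>'
      by (rule adjoint_map_eqI[OF dE])
        (use \<psi> \<psi>' adjoint_map_pair[OF \<psi>] adjoint_map_pair[OF \<psi>']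
          is_dual_pair_linear[OF dE] is_dual_pair_linear[OF dF] Sd in auto)
    have nn: "0 \<le> nrm (level F (Suc j)) \<psi>"
      using dF \<psi> by (auto simp: is_dual_def normed_space_def)
    show "nrm (level E (Suc i)) (?T \<psi>) \<le> K * nrm (level F (Suc j)) \<psi>"
    proof (rule is_dual_nrm_le[OF nE dE])
      fix e assume e: "e \<in> carrier (level E i)"
      have "norm (pair F j \<psi> (S e)) \<le> nrm (level F (Suc j)) \<psi> * nrm (level F j) (S e)"
        by (rule is_dual_bound(2)[OF nF dF \<psi> Sd(1)[OF e]])
      also have "\<dots> \<le> nrm (level F (Suc j)) \<psi> * (K * nrm (level E i) e)"
        using K(2)[OF e] nn by (rule mult_left_mono)
      finally show "norm (pair E i (?T \<psi>) e) \<le> K * nrm (level F (Suc j)) \<psi> * nrm (level E i) e"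
        using adjoint_map_pair(2)[OF \<psi> e] by (simp add: mult_ac)
    qed (use \<psi> adjoint_map_pair K nn in auto)
  qed
qed

end

text \<open>The zero functional is the candidate. Vanishing of S is asked on the carrier only,
  because actions are unconstrained outside it.\<close>

lemma adjoint_map_zero:
  fixes E :: "('k :: {real_normed_field, banach}, 'u) tower" and F :: "('k, 'v) tower"
  assumes nF: "normed_space (level F j)"
    and dE: "is_dual (level E i) (level E (Suc i)) (pair E i)"
    and dF: "is_dual (level F j) (level F (Suc j)) (pair F j)"
    and S: "\<And>e. e \<in> carrier (level E i) \<Longrightarrow> S e = \<zero>\<^bsub>level F j\<^esub>"
    and \<psi>: "\<psi> \<in> carrier (level F (Suc j))"
  shows "adjoint_map E i F j S \<psi> = \<zero>\<^bsub>level E (Suc i)\<^esub>"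
proof (rule adjoint_map_eqI[OF dE])
  interpret E': module "scalar_ring :: 'k ring" "level E (Suc i)"
    using dE by (simp add: is_dual_def normed_space_def)
  show "\<zero>\<^bsub>level E (Suc i)\<^esub> \<in> carrier (level E (Suc i))" by simp
qed (simp add: S is_dual_pair_zero[OF dE] is_dual_bound(4)[OF nF dF \<psi>])

section \<open>Iterated dual modules\<close>

text \<open>A tower of height m has m pairings but m + 1 levels, hence the weak inequality here and
  the strict one in \<open>dual_tower_is_dual\<close>. Above level 0, being normed is part of
  \<open>is_dual\<close>.\<close>

lemma dual_tower_normed:
  assumes "dual_tower m V E" "normed_space V" "k \<le> m"
  shows "normed_space (level E k)"
  using assms by (cases k) (auto simp: dual_tower_def is_dual_def)

lemma dual_tower_is_dual:
  assumes "dual_tower m V E" "k < m"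
  shows "is_dual (level E k) (level E (Suc k)) (pair E k)"
  using assms by (auto simp: dual_tower_def)

lemma banach_algebra_normed: "banach_algebra B \<Longrightarrow> normed_space B"
  by (simp add: banach_algebra_def banach_space_def)

lemma banach_bimodule_regular:
  assumes "banach_algebra B"
  shows "banach_bimodule B (regular_bimodule B)"
proof -
  have le: "nrm B (b \<otimes>\<^bsub>B\<^esub> c) \<le> nrm B b * nrm B c" if "b \<in> carrier B" "c \<in> carrier B" for b c
    using assms that unfolding banach_algebra_def by blast
  \<comment> \<open>The factor 1 is the witness for the constant K of a bimodule.\<close>
  have "nrm B (b \<otimes>\<^bsub>B\<^esub> c) \<le> 1 * nrm B b * nrm B c \<and> nrm B (c \<otimes>\<^bsub>B\<^esub> b) \<le> 1 * nrm B b * nrm B c"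
    if "b \<in> carrier B" "c \<in> carrier B" for b c
    using le[OF that] le[OF that(2,1)] by (simp add: mult.commute)
  then have "\<exists>K. \<forall>b\<in>carrier B. \<forall>c\<in>carrier B.
      nrm B (b \<otimes>\<^bsub>B\<^esub> c) \<le> K * nrm B b * nrm B c \<and> nrm B (c \<otimes>\<^bsub>B\<^esub> b) \<le> K * nrm B b * nrm B c"
    by blast
  then show ?thesis
    using assms unfolding banach_bimodule_def regular_bimodule_def
    by (simp add: banach_algebra_def)
qed

lemma banach_bimodule_normed: "banach_bimodule B M \<Longrightarrow> normed_space (space M)"
  by (simp add: banach_bimodule_def banach_space_def)

lemma banach_bimodule_bounded_linear:
  assumes M: "banach_bimodule B M" and b: "b \<in> carrier B"
  shows "bounded_linear_map (space M) (space M) (left M b)"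
    and "bounded_linear_map (space M) (space M) (\<lambda>e. right M e b)"
proof -
  obtain K where "\<forall>b\<in>carrier B. \<forall>e\<in>carrier (space M).
      nrm (space M) (left M b e) \<le> K * nrm B b * nrm (space M) e \<and>
      nrm (space M) (right M e b) \<le> K * nrm B b * nrm (space M) e"
    using M unfolding banach_bimodule_def by blast
  moreover have "linear_map (space M) (space M) (left M b)"
    "linear_map (space M) (space M) (\<lambda>e. right M e b)"
    using M b by (auto simp: banach_bimodule_def)
  ultimately show "bounded_linear_map (space M) (space M) (left M b)"
    "bounded_linear_map (space M) (space M) (\<lambda>e. right M e b)"
    unfolding bounded_linear_map_def using b by blast+
qed

text \<open>Here the module element is fixed and the algebra element varies. At level 0 the mixed
  products xF and Fx, as functions of F in A, are exactly these orbit maps.\<close>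

lemma banach_bimodule_bounded_linear_orbit:
  assumes M: "banach_bimodule B M" and e: "e \<in> carrier (space M)"
  shows "bounded_linear_map B (space M) (\<lambda>b. left M b e)"
    and "bounded_linear_map B (space M) (right M e)"
proof -
  obtain K where K: "\<forall>b\<in>carrier B. \<forall>e\<in>carrier (space M).
      nrm (space M) (left M b e) \<le> K * nrm B b * nrm (space M) e \<and>
      nrm (space M) (right M e b) \<le> K * nrm B b * nrm (space M) e"
    using M unfolding banach_bimodule_def by blast
  have "\<forall>b\<in>carrier B. nrm (space M) (left M b e) \<le> (K * nrm (space M) e) * nrm B b"
    "\<forall>b\<in>carrier B. nrm (space M) (right M e b) \<le> (K * nrm (space M) e) * nrm B b"
    using K e by (simp_all add: mult_ac)
  moreover have "linear_map B (space M) (\<lambda>b. left M b e)" "linear_map B (space M) (right M e)"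
    using M e by (auto simp: banach_bimodule_def)
  ultimately show "bounded_linear_map B (space M) (\<lambda>b. left M b e)"
    "bounded_linear_map B (space M) (right M e)"
    unfolding bounded_linear_map_def by blast+
qed

lemma banach_bimodule_zero:
  assumes M: "banach_bimodule B M" and e: "e \<in> carrier (space M)"
  shows "left M \<zero>\<^bsub>B\<^esub> e = \<zero>\<^bsub>space M\<^esub>" "right M e \<zero>\<^bsub>B\<^esub> = \<zero>\<^bsub>space M\<^esub>"
proof -
  have "linear_map B (space M) (\<lambda>b. left M b e)" "linear_map B (space M) (\<lambda>b. right M e b)"
    using M e by (auto simp: banach_bimodule_def)
  moreover have "normed_space B" "normed_space (space M)"
    using M banach_bimodule_normed[OF M] by (auto simp: banach_bimodule_def intro: banach_algebra_normed)
  ultimately show "left M \<zero>\<^bsub>B\<^esub> e = \<zero>\<^bsub>space M\<^esub>" "right M e \<zero>\<^bsub>B\<^esub> = \<zero>\<^bsub>space M\<^esub>"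
    using linear_map_zero by blast+
qed

text \<open>Both sides go through one induction, since the left action on a dual is the adjoint of
  the right action below it, and conversely.\<close>

lemma bounded_linear_dual_act:
  fixes E :: "('k :: {real_normed_field, banach}, 'e) tower"
  assumes M: "banach_bimodule B M" and E: "dual_tower m (space M) E"
    and b: "b \<in> carrier B" and "k \<le> m"
  shows "bounded_linear_map (level E k) (level E k) (lact E M k b)"
    and "bounded_linear_map (level E k) (level E k) (\<lambda>\<phi>. ract E M k \<phi> b)"
proof -
  have "bounded_linear_map (level E k) (level E k) (lact E M k b) \<and>
    bounded_linear_map (level E k) (level E k) (\<lambda>\<phi>. ract E M k \<phi> b)"
    using \<open>k \<le> m\<close>
  proof (induction k)
    case 0
    have "level E 0 = space M" using E by (simp add: dual_tower_def)
    moreover have "lact E M 0 b = left M b" by (rule ext) simp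
    ultimately show ?case
      using banach_bimodule_bounded_linear[OF M b] by simp
  next
    case (Suc k)
    have n: "normed_space (level E k)"
      using Suc dual_tower_normed[OF E banach_bimodule_normed[OF M]] by simp
    have d: "is_dual (level E k) (level E (Suc k)) (pair E k)"
      using Suc dual_tower_is_dual[OF E] by simp
    have "lact E M (Suc k) b = adjoint_map E k E k (\<lambda>e. ract E M k e b)"
      "(\<lambda>\<phi>. ract E M (Suc k) \<phi> b) = adjoint_map E k E k (lact E M k b)"
      by auto
    then show ?case
      using Suc bounded_linear_adjoint_map[OF n n d d] by simp
  qed
  then show "bounded_linear_map (level E k) (level E k) (lact E M k b)"
    "bounded_linear_map (level E k) (level E k) (\<lambda>\<phi>. ract E M k \<phi> b)" by auto
qed

lemma dual_act_pair:
  fixes E :: "('k :: {real_normed_field, banach}, 'e) tower"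
  assumes M: "banach_bimodule B M" and E: "dual_tower m (space M) E"
    and b: "b \<in> carrier B" and k: "k < m"
    and \<phi>: "\<phi> \<in> carrier (level E (Suc k))" and e: "e \<in> carrier (level E k)"
  shows "pair E k (lact E M (Suc k) b \<phi>) e = pair E k \<phi> (ract E M k e b)"
    and "pair E k (ract E M (Suc k) \<phi> b) e = pair E k \<phi> (lact E M k b e)"
proof -
  have n: "normed_space (level E k)"
    using k dual_tower_normed[OF E banach_bimodule_normed[OF M]] by simp
  note d = dual_tower_is_dual[OF E k]
  note bl = bounded_linear_dual_act[OF M E b less_imp_le[OF k]]
  show "pair E k (lact E M (Suc k) b \<phi>) e = pair E k \<phi> (ract E M k e b)"
    using adjoint_map_pair(2)[OF n n d d bl(2) \<phi> e] by simp
  show "pair E k (ract E M (Suc k) \<phi> b) e = pair E k \<phi> (lact E M k b e)"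
    using adjoint_map_pair(2)[OF n n d d bl(1) \<phi> e] by simp
qed

text \<open>Needed to isolate the two summands in products with (a, 0) and (0, x). The induction
  generalises over \<phi>, because \<open>adjoint_map_zero\<close> wants vanishing on the whole
  level below.\<close>

lemma dual_act_zero:
  fixes E :: "('k :: {real_normed_field, banach}, 'e) tower"
  assumes M: "banach_bimodule B M" and E: "dual_tower m (space M) E"
    and "k \<le> m" and "\<phi> \<in> carrier (level E k)"
  shows "lact E M k \<zero>\<^bsub>B\<^esub> \<phi> = \<zero>\<^bsub>level E k\<^esub>" "ract E M k \<phi> \<zero>\<^bsub>B\<^esub> = \<zero>\<^bsub>level E k\<^esub>"
proof -
  have "lact E M k \<zero>\<^bsub>B\<^esub> \<phi> = \<zero>\<^bsub>level E k\<^esub> \<and> ract E M k \<phi> \<zero>\<^bsub>B\<^esub> = \<zero>\<^bsub>level E k\<^esub>"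
    using assms(3,4)
  proof (induction k arbitrary: \<phi>)
    case 0
    have "level E 0 = space M" using E by (simp add: dual_tower_def)
    then show ?case
      using banach_bimodule_zero[OF M] 0 by simp
  next
    case (Suc k)
    have n: "normed_space (level E k)"
      using Suc dual_tower_normed[OF E banach_bimodule_normed[OF M]] by simp
    have d: "is_dual (level E k) (level E (Suc k)) (pair E k)"
      using Suc dual_tower_is_dual[OF E] by simp
    show ?case
      using Suc adjoint_map_zero[OF n d d] by simp
  qed
  then show "lact E M k \<zero>\<^bsub>B\<^esub> \<phi> = \<zero>\<^bsub>level E k\<^esub>" "ract E M k \<phi> \<zero>\<^bsub>B\<^esub> = \<zero>\<^bsub>level E k\<^esub>" by auto
qed

section \<open>The iterated duals of the product algebra\<close>

text \<open>The height m is fixed and left general, so that induction on k runs inside one tower;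
  the theorem takes m = 2n.\<close>

locale bowtie_duals =
  fixes A :: "('k :: {real_normed_field, banach}, 'a) nspace"
    and X :: "('k, 'x) nspace"
    and M :: "('k, 'a, 'x) bimodule"
    and P :: "('k, 'a) tower" and Q :: "('k, 'x) tower" and m :: nat
  assumes alg: "algebraic_banach_module A X M"
    and P: "dual_tower m A P" and Q: "dual_tower m X Q"
begin

abbreviation "RA \<equiv> regular_bimodule A"
abbreviation "RX \<equiv> regular_bimodule X"
abbreviation "BT \<equiv> bowtie_tower P Q M"
abbreviation "RB \<equiv> regular_bimodule (bowtie A X M)"

lemma space_simps [simp]: "space M = X" "space RA = A" "space RX = X"
  using alg by (simp_all add: algebraic_banach_module_def regular_bimodule_def)

lemma bimodules: "banach_bimodule A M" "banach_bimodule A RA" "banach_bimodule X RX"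
  using alg by (simp_all add: algebraic_banach_module_def banach_bimodule_regular)

lemma normed_base: "normed_space A" "normed_space X"
  using banach_bimodule_normed[OF bimodules(2)] banach_bimodule_normed[OF bimodules(3)] by simp_all

lemma level_0 [simp]: "level P 0 = A" "level Q 0 = X"
  using P Q by (simp_all add: dual_tower_def)

lemmas dual_P = dual_tower_is_dual[OF P]
lemmas dual_Q = dual_tower_is_dual[OF Q]
lemmas normed_P = dual_tower_normed[OF P normed_base(1)]
lemmas normed_Q = dual_tower_normed[OF Q normed_base(2)]
lemmas group_P = normed_space_abelian_group[OF normed_P]
lemmas group_Q = normed_space_abelian_group[OF normed_Q]

text \<open>Three modules live on two towers: A acts on the duals of A and of X, and X acts on the
  duals of X. In this form the generic facts on dual modules apply to each.\<close>

lemma towers: "dual_tower m (space M) Q" "dual_tower m (space RA) P" "dual_tower m (space RX) Q"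
  using P Q by simp_all

lemmas act_A = bounded_linear_dual_act[OF bimodules(2) towers(2)]
lemmas act_M = bounded_linear_dual_act[OF bimodules(1) towers(1)]
lemmas act_X = bounded_linear_dual_act[OF bimodules(3) towers(3)]
lemmas act_A_pair = dual_act_pair[OF bimodules(2) towers(2)]
lemmas act_M_pair = dual_act_pair[OF bimodules(1) towers(1)]
lemmas act_X_pair = dual_act_pair[OF bimodules(3) towers(3)]
lemmas act_A_zero = dual_act_zero[OF bimodules(2) towers(2)]
lemmas act_M_zero = dual_act_zero[OF bimodules(1) towers(1)]
lemmas act_X_zero = dual_act_zero[OF bimodules(3) towers(3)]

section \<open>Boundedness and pairing identities of the mixed products\<close>

lemma mix_odd_of_even:
  assumes k: "2*k < m"
    and even: "bounded_linear_map (level P (2*k)) (level Q (2*k)) (mixl P Q M k x)"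
      "bounded_linear_map (level P (2*k)) (level Q (2*k)) (\<lambda>F. mixr P Q M k F x)"
  shows "bounded_linear_map (level Q (Suc (2*k))) (level P (Suc (2*k))) (mixl_odd P Q M k x)"
    and "bounded_linear_map (level Q (Suc (2*k))) (level P (Suc (2*k))) (\<lambda>g. mixr_odd P Q M k g x)"
proof -
  note n = normed_P[OF less_imp_le[OF k]] normed_Q[OF less_imp_le[OF k]] dual_P[OF k] dual_Q[OF k]
  have "mixl_odd P Q M k x = adjoint_map P (2*k) Q (2*k) (\<lambda>F. mixr P Q M k F x)"
    "(\<lambda>g. mixr_odd P Q M k g x) = adjoint_map P (2*k) Q (2*k) (mixl P Q M k x)"
    by auto
  then show "bounded_linear_map (level Q (Suc (2*k))) (level P (Suc (2*k))) (mixl_odd P Q M k x)"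
    "bounded_linear_map (level Q (Suc (2*k))) (level P (Suc (2*k))) (\<lambda>g. mixr_odd P Q M k g x)"
    using bounded_linear_adjoint_map[OF n even(1)] bounded_linear_adjoint_map[OF n even(2)] by simp_all
qed

text \<open>Each induction step dualises twice: the maps from duals of A to duals of X turn into
  maps from duals of X to duals of A, and then back.\<close>

lemma bounded_linear_mix:
  assumes x: "x \<in> carrier X" and "2*k \<le> m"
  shows "bounded_linear_map (level P (2*k)) (level Q (2*k)) (mixl P Q M k x)"
    and "bounded_linear_map (level P (2*k)) (level Q (2*k)) (\<lambda>F. mixr P Q M k F x)"
proof -
  have "bounded_linear_map (level P (2*k)) (level Q (2*k)) (mixl P Q M k x) \<and>
    bounded_linear_map (level P (2*k)) (level Q (2*k)) (\<lambda>F. mixr P Q M k F x)"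
    using \<open>2*k \<le> m\<close>
  proof (induction k)
    case 0
    have "mixl P Q M 0 x = right M x" by (rule ext) simp
    then show ?case
      using banach_bimodule_bounded_linear_orbit[OF bimodules(1), of x] x by simp
  next
    case (Suc k)
    then have k: "2*k < m" "Suc (2*k) \<le> m" "Suc (2*k) < m" by auto
    note n = normed_Q[OF k(2)] normed_P[OF k(2)] dual_Q[OF k(3)] dual_P[OF k(3)]
    have odd: "bounded_linear_map (level Q (Suc (2*k))) (level P (Suc (2*k))) (mixl_odd P Q M k x)"
      "bounded_linear_map (level Q (Suc (2*k))) (level P (Suc (2*k))) (\<lambda>g. mixr_odd P Q M k g x)"
      using mix_odd_of_even[OF k(1)] Suc by auto
    have "mixl P Q M (Suc k) x = adjoint_map Q (Suc (2*k)) P (Suc (2*k)) (\<lambda>g. mixr_odd P Q M k g x)"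
      "(\<lambda>F. mixr P Q M (Suc k) F x) = adjoint_map Q (Suc (2*k)) P (Suc (2*k)) (mixl_odd P Q M k x)"
      by auto
    then show ?case
      using bounded_linear_adjoint_map[OF n odd(1)] bounded_linear_adjoint_map[OF n odd(2)] by simp
  qed
  then show "bounded_linear_map (level P (2*k)) (level Q (2*k)) (mixl P Q M k x)"
    "bounded_linear_map (level P (2*k)) (level Q (2*k)) (\<lambda>F. mixr P Q M k F x)" by auto
qed

lemma bounded_linear_mix_odd:
  assumes "x \<in> carrier X" "2*k < m"
  shows "bounded_linear_map (level Q (Suc (2*k))) (level P (Suc (2*k))) (mixl_odd P Q M k x)"
    and "bounded_linear_map (level Q (Suc (2*k))) (level P (Suc (2*k))) (\<lambda>g. mixr_odd P Q M k g x)"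
  using mix_odd_of_even assms bounded_linear_mix by auto

lemma mix_odd_pair:
  assumes x: "x \<in> carrier X" and k: "2*k < m"
    and g: "g \<in> carrier (level Q (Suc (2*k)))" and F: "F \<in> carrier (level P (2*k))"
  shows "pair P (2*k) (mixl_odd P Q M k x g) F = pair Q (2*k) g (mixr P Q M k F x)"
    and "pair P (2*k) (mixr_odd P Q M k g x) F = pair Q (2*k) g (mixl P Q M k x F)"
proof -
  note n = normed_P[OF less_imp_le[OF k]] normed_Q[OF less_imp_le[OF k]] dual_P[OF k] dual_Q[OF k]
  note bl = bounded_linear_mix[OF x less_imp_le[OF k]]
  show "pair P (2*k) (mixl_odd P Q M k x g) F = pair Q (2*k) g (mixr P Q M k F x)"
    "pair P (2*k) (mixr_odd P Q M k g x) F = pair Q (2*k) g (mixl P Q M k x F)"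
    using adjoint_map_pair(2)[OF n bl(1) g F] adjoint_map_pair(2)[OF n bl(2) g F] by simp_all
qed

lemma mix_Suc_pair:
  assumes x: "x \<in> carrier X" and k: "Suc (2*k) < m"
    and F: "F \<in> carrier (level P (Suc (Suc (2*k))))" and g: "g \<in> carrier (level Q (Suc (2*k)))"
  shows "pair Q (Suc (2*k)) (mixl P Q M (Suc k) x F) g = pair P (Suc (2*k)) F (mixr_odd P Q M k g x)"
    and "pair Q (Suc (2*k)) (mixr P Q M (Suc k) F x) g = pair P (Suc (2*k)) F (mixl_odd P Q M k x g)"
proof -
  note n = normed_Q[OF less_imp_le[OF k]] normed_P[OF less_imp_le[OF k]] dual_Q[OF k] dual_P[OF k]
  note bl = bounded_linear_mix_odd[OF x Suc_lessD[OF k]]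
  show "pair Q (Suc (2*k)) (mixl P Q M (Suc k) x F) g = pair P (Suc (2*k)) F (mixr_odd P Q M k g x)"
    "pair Q (Suc (2*k)) (mixr P Q M (Suc k) F x) g = pair P (Suc (2*k)) F (mixl_odd P Q M k x g)"
    using adjoint_map_pair(2)[OF n bl(1) F g] adjoint_map_pair(2)[OF n bl(2) F g] by simp_all
qed

lemma mix_zero:
  assumes "2*k \<le> m" "F \<in> carrier (level P (2*k))"
  shows "mixl P Q M k \<zero>\<^bsub>X\<^esub> F = \<zero>\<^bsub>level Q (2*k)\<^esub>" "mixr P Q M k F \<zero>\<^bsub>X\<^esub> = \<zero>\<^bsub>level Q (2*k)\<^esub>"
proof -
  have "mixl P Q M k \<zero>\<^bsub>X\<^esub> F = \<zero>\<^bsub>level Q (2*k)\<^esub> \<and> mixr P Q M k F \<zero>\<^bsub>X\<^esub> = \<zero>\<^bsub>level Q (2*k)\<^esub>"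
    using assms
  proof (induction k arbitrary: F)
    case 0
    \<comment> \<open>At level 0 the vanishing argument is the module vector, not the algebra
      element, so linearity in the vector is what counts.\<close>
    have "linear_map X X (left M F)" "linear_map X X (\<lambda>e. right M e F)"
      using 0 bimodules(1) by (auto simp: banach_bimodule_def)
    then show ?case
      using linear_map_zero[OF normed_base(2) normed_base(2)] by auto
  next
    case (Suc k)
    then have k: "2*k < m" "2*k \<le> m" "Suc (2*k) \<le> m" "Suc (2*k) < m" by auto
    have "mixl_odd P Q M k \<zero>\<^bsub>X\<^esub> g = \<zero>\<^bsub>level P (Suc (2*k))\<^esub>"
      "mixr_odd P Q M k g \<zero>\<^bsub>X\<^esub> = \<zero>\<^bsub>level P (Suc (2*k))\<^esub>"
      if "g \<in> carrier (level Q (Suc (2*k)))" for g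
      using adjoint_map_zero[OF normed_Q[OF k(2)] dual_P[OF k(1)] dual_Q[OF k(1)] _ that]
        Suc.IH[OF k(2)] by simp_all
    then show ?case
      using adjoint_map_zero[OF normed_P[OF k(3)] dual_Q[OF k(4)] dual_P[OF k(4)]] Suc.prems(2)
      by simp
  qed
  then show "mixl P Q M k \<zero>\<^bsub>X\<^esub> F = \<zero>\<^bsub>level Q (2*k)\<^esub>" "mixr P Q M k F \<zero>\<^bsub>X\<^esub> = \<zero>\<^bsub>level Q (2*k)\<^esub>"
    by auto
qed

section \<open>Componentwise structure of the dual tower of the product algebra\<close>

lemma bowtie_level [simp]:
  "carrier (level BT k) = carrier (level P k) \<times> carrier (level Q k)"
  "\<zero>\<^bsub>level BT k\<^esub> = (\<zero>\<^bsub>level P k\<^esub>, \<zero>\<^bsub>level Q k\<^esub>)"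
  "(F, G) \<oplus>\<^bsub>level BT k\<^esub> (F', G') = (F \<oplus>\<^bsub>level P k\<^esub> F', G \<oplus>\<^bsub>level Q k\<^esub> G')"
  "c \<odot>\<^bsub>level BT k\<^esub> (F, G) = (c \<odot>\<^bsub>level P k\<^esub> F, c \<odot>\<^bsub>level Q k\<^esub> G)"
  "pair BT k (f, g) (F, G) = pair P k f F + pair Q k g G"
  \<comment> \<open>Level 0 is an algebra and the higher levels are bare product spaces, but
    carrier, zero, sum and scalar multiple agree, so the rules need no case distinction on
    k.\<close>
  by (simp_all add: bowtie_tower_def bowtie_def prod_space_def)

lemma bowtie_level_nrm [simp]:
  "even k \<Longrightarrow> nrm (level BT k) (F, G) = nrm (level P k) F + nrm (level Q k) G"
  by (simp add: bowtie_tower_def)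

lemmas tower_BT = dual_tower_bowtie_tower[OF normed_base P Q, of M]
lemmas dual_BT = dual_tower_is_dual[OF tower_BT]

lemma group_BT:
  assumes k: "k \<le> m"
  shows "abelian_group (level BT k)"
proof -
  interpret P: abelian_group "level P k" by (rule group_P[OF k])
  interpret Q: abelian_group "level Q k" by (rule group_Q[OF k])
  show ?thesis
  proof (rule abelian_groupI)
    fix \<Phi> assume "\<Phi> \<in> carrier (level BT k)"
    then obtain F G where \<Phi>: "\<Phi> = (F, G)" "F \<in> carrier (level P k)" "G \<in> carrier (level Q k)"
      by auto
    show "\<exists>\<Psi>\<in>carrier (level BT k). \<Psi> \<oplus>\<^bsub>level BT k\<^esub> \<Phi> = \<zero>\<^bsub>level BT k\<^esub>"
      by (rule bexI[of _ "(\<ominus>\<^bsub>level P k\<^esub> F, \<ominus>\<^bsub>level Q k\<^esub> G)"])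
        (use \<Phi> in \<open>auto simp: P.l_neg Q.l_neg\<close>)
  qed (auto simp: P.a_ac Q.a_ac)
qed

lemma bowtie_minus:
  assumes k: "k \<le> m" and "F \<in> carrier (level P k)" "G \<in> carrier (level Q k)"
    "F' \<in> carrier (level P k)" "G' \<in> carrier (level Q k)"
  shows "(F, G) \<ominus>\<^bsub>level BT k\<^esub> (F', G') = (F \<ominus>\<^bsub>level P k\<^esub> F', G \<ominus>\<^bsub>level Q k\<^esub> G')"
proof -
  interpret P: abelian_group "level P k" by (rule group_P[OF k])
  interpret Q: abelian_group "level Q k" by (rule group_Q[OF k])
  interpret B: abelian_group "level BT k" by (rule group_BT[OF k])
  show ?thesis
    \<comment> \<open>Taking the difference itself as third argument yields
      \<open>F = (F \<ominus> F') \<oplus> F'\<close> in each component, which is what the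
      characterisation asks of the pair.\<close>
    using assms P.minus_eq_iff[of F F' "F \<ominus>\<^bsub>level P k\<^esub> F'"]
      Q.minus_eq_iff[of G G' "G \<ominus>\<^bsub>level Q k\<^esub> G'"]
    by (subst B.minus_eq_iff) auto
qed

text \<open>Pairing (f, g) with (F, G)(a, x) produces the term \<langle>g, Fx\<rangle> =
  \<langle>xg, F\<rangle>. It depends on F, so xg joins the first component; the right action is
  symmetric.\<close>

lemma bowtie_act_odd_of_even:
  assumes k: "2*k < m" and a: "a \<in> carrier A" and x: "x \<in> carrier X"
    and even: "\<And>F G. F \<in> carrier (level P (2*k)) \<Longrightarrow> G \<in> carrier (level Q (2*k)) \<Longrightarrow>
      lact BT RB (2*k) (a, x) (F, G) =
        (lact P RA (2*k) a F,
         mixl P Q M k x F \<oplus>\<^bsub>level Q (2*k)\<^esub> lact Q M (2*k) a G \<oplus>\<^bsub>level Q (2*k)\<^esub> lact Q RX (2*k) x G) \<and>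
      ract BT RB (2*k) (F, G) (a, x) =
        (ract P RA (2*k) F a,
         mixr P Q M k F x \<oplus>\<^bsub>level Q (2*k)\<^esub> ract Q M (2*k) G a \<oplus>\<^bsub>level Q (2*k)\<^esub> ract Q RX (2*k) G x)"
    and f: "f \<in> carrier (level P (Suc (2*k)))" and g: "g \<in> carrier (level Q (Suc (2*k)))"
  shows "lact BT RB (Suc (2*k)) (a, x) (f, g) =
        (lact P RA (Suc (2*k)) a f \<oplus>\<^bsub>level P (Suc (2*k))\<^esub> mixl_odd P Q M k x g,
         lact Q M (Suc (2*k)) a g \<oplus>\<^bsub>level Q (Suc (2*k))\<^esub> lact Q RX (Suc (2*k)) x g)"
    and "ract BT RB (Suc (2*k)) (f, g) (a, x) =
        (ract P RA (Suc (2*k)) f a \<oplus>\<^bsub>level P (Suc (2*k))\<^esub> mixr_odd P Q M k g x,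
         ract Q M (Suc (2*k)) g a \<oplus>\<^bsub>level Q (Suc (2*k))\<^esub> ract Q RX (Suc (2*k)) g x)"
proof -
  have k': "2*k \<le> m" "Suc (2*k) \<le> m" using k by auto
  interpret P': abelian_group "level P (Suc (2*k))" by (rule group_P[OF k'(2)])
  interpret Q': abelian_group "level Q (Suc (2*k))" by (rule group_Q[OF k'(2)])
  interpret Q: abelian_group "level Q (2*k)" by (rule group_Q[OF k'(1)])
  note bl = act_A[OF a k'(1)] act_M[OF a k'(1)] act_X[OF x k'(1)] bounded_linear_mix[OF x k'(1)]
    act_A[OF a k'(2)] act_M[OF a k'(2)] act_X[OF x k'(2)] bounded_linear_mix_odd[OF x k]
  note cl = bl[THEN bounded_linear_mapD(1)]
  note pairs = act_A_pair[OF a k f] act_M_pair[OF a k g] act_X_pair[OF x k g] mix_odd_pair[OF x k g]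
  note add = is_dual_pair_linear(1)[OF dual_P[OF k]] is_dual_pair_linear(2)[OF dual_P[OF k]]
    is_dual_pair_linear(1)[OF dual_Q[OF k]] is_dual_pair_linear(2)[OF dual_Q[OF k]]
  show "lact BT RB (Suc (2*k)) (a, x) (f, g) =
        (lact P RA (Suc (2*k)) a f \<oplus>\<^bsub>level P (Suc (2*k))\<^esub> mixl_odd P Q M k x g,
         lact Q M (Suc (2*k)) a g \<oplus>\<^bsub>level Q (Suc (2*k))\<^esub> lact Q RX (Suc (2*k)) x g)"
    \<comment> \<open>Only the action on the product tower is unfolded. Component actions and mixed
      products must stay folded for the identities in \<open>pairs\<close> to apply.\<close>
    unfolding lact.simps(2)[of BT]
    by (rule adjoint_map_eqI[OF dual_BT[OF k]])
      (use f g cl in \<open>auto simp: pairs add even simp del: lact.simps ract.simps mixl_odd.simps mixr_odd.simps\<close>)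
  show "ract BT RB (Suc (2*k)) (f, g) (a, x) =
        (ract P RA (Suc (2*k)) f a \<oplus>\<^bsub>level P (Suc (2*k))\<^esub> mixr_odd P Q M k g x,
         ract Q M (Suc (2*k)) g a \<oplus>\<^bsub>level Q (Suc (2*k))\<^esub> ract Q RX (Suc (2*k)) g x)"
    unfolding ract.simps(2)[of BT]
    by (rule adjoint_map_eqI[OF dual_BT[OF k]])
      (use f g cl in \<open>auto simp: pairs add even simp del: lact.simps ract.simps mixl_odd.simps mixr_odd.simps\<close>)
qed

text \<open>Pairing (F, G) with (f, g)(a, x) produces \<langle>F, gx\<rangle> = \<langle>xF,
  g\<rangle>. It depends on g, so the mixed term returns to the second component.\<close>

lemma bowtie_act_Suc_of_odd:
  assumes k: "Suc (2*k) < m" and a: "a \<in> carrier A" and x: "x \<in> carrier X"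
    and odd: "\<And>f g. f \<in> carrier (level P (Suc (2*k))) \<Longrightarrow> g \<in> carrier (level Q (Suc (2*k))) \<Longrightarrow>
      lact BT RB (Suc (2*k)) (a, x) (f, g) =
        (lact P RA (Suc (2*k)) a f \<oplus>\<^bsub>level P (Suc (2*k))\<^esub> mixl_odd P Q M k x g,
         lact Q M (Suc (2*k)) a g \<oplus>\<^bsub>level Q (Suc (2*k))\<^esub> lact Q RX (Suc (2*k)) x g) \<and>
      ract BT RB (Suc (2*k)) (f, g) (a, x) =
        (ract P RA (Suc (2*k)) f a \<oplus>\<^bsub>level P (Suc (2*k))\<^esub> mixr_odd P Q M k g x,
         ract Q M (Suc (2*k)) g a \<oplus>\<^bsub>level Q (Suc (2*k))\<^esub> ract Q RX (Suc (2*k)) g x)"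
    and F: "F \<in> carrier (level P (Suc (Suc (2*k))))" and G: "G \<in> carrier (level Q (Suc (Suc (2*k))))"
  shows "lact BT RB (Suc (Suc (2*k))) (a, x) (F, G) =
        (lact P RA (Suc (Suc (2*k))) a F,
         mixl P Q M (Suc k) x F \<oplus>\<^bsub>level Q (Suc (Suc (2*k)))\<^esub> lact Q M (Suc (Suc (2*k))) a G
           \<oplus>\<^bsub>level Q (Suc (Suc (2*k)))\<^esub> lact Q RX (Suc (Suc (2*k))) x G)"
    and "ract BT RB (Suc (Suc (2*k))) (F, G) (a, x) =
        (ract P RA (Suc (Suc (2*k))) F a,
         mixr P Q M (Suc k) F x \<oplus>\<^bsub>level Q (Suc (Suc (2*k)))\<^esub> ract Q M (Suc (Suc (2*k))) G a
           \<oplus>\<^bsub>level Q (Suc (Suc (2*k)))\<^esub> ract Q RX (Suc (Suc (2*k))) G x)"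
proof -
  have k': "Suc (2*k) \<le> m" "Suc (Suc (2*k)) \<le> m" "2 * Suc k \<le> m" "2*k < m" using k by auto
  interpret P1: abelian_group "level P (Suc (2*k))" by (rule group_P[OF k'(1)])
  interpret Q1: abelian_group "level Q (Suc (2*k))" by (rule group_Q[OF k'(1)])
  interpret Q2: abelian_group "level Q (Suc (Suc (2*k)))" by (rule group_Q[OF k'(2)])
  have mix: "bounded_linear_map (level P (Suc (Suc (2*k)))) (level Q (Suc (Suc (2*k)))) (mixl P Q M (Suc k) x)"
    "bounded_linear_map (level P (Suc (Suc (2*k)))) (level Q (Suc (Suc (2*k)))) (\<lambda>F. mixr P Q M (Suc k) F x)"
    using bounded_linear_mix[OF x k'(3)] by simp_all
  note bl = act_A[OF a k'(1)] act_M[OF a k'(1)] act_X[OF x k'(1)] bounded_linear_mix_odd[OF x k'(4)]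
    act_A[OF a k'(2)] act_M[OF a k'(2)] act_X[OF x k'(2)] mix
  note cl = bl[THEN bounded_linear_mapD(1)]
  note pairs = act_A_pair[OF a k F] act_M_pair[OF a k G] act_X_pair[OF x k G] mix_Suc_pair[OF x k F]
  note add = is_dual_pair_linear(1)[OF dual_P[OF k]] is_dual_pair_linear(2)[OF dual_P[OF k]]
    is_dual_pair_linear(1)[OF dual_Q[OF k]] is_dual_pair_linear(2)[OF dual_Q[OF k]]
  show "lact BT RB (Suc (Suc (2*k))) (a, x) (F, G) =
        (lact P RA (Suc (Suc (2*k))) a F,
         mixl P Q M (Suc k) x F \<oplus>\<^bsub>level Q (Suc (Suc (2*k)))\<^esub> lact Q M (Suc (Suc (2*k))) a G
           \<oplus>\<^bsub>level Q (Suc (Suc (2*k)))\<^esub> lact Q RX (Suc (Suc (2*k))) x G)"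
    unfolding lact.simps(2)[of BT]
    by (rule adjoint_map_eqI[OF dual_BT[OF k]])
      (use F G cl in \<open>auto simp: pairs add odd simp del: lact.simps ract.simps mixl.simps mixr.simps mixl_odd.simps mixr_odd.simps\<close>)
  show "ract BT RB (Suc (Suc (2*k))) (F, G) (a, x) =
        (ract P RA (Suc (Suc (2*k))) F a,
         mixr P Q M (Suc k) F x \<oplus>\<^bsub>level Q (Suc (Suc (2*k)))\<^esub> ract Q M (Suc (Suc (2*k))) G a
           \<oplus>\<^bsub>level Q (Suc (Suc (2*k)))\<^esub> ract Q RX (Suc (Suc (2*k))) G x)"
    unfolding ract.simps(2)[of BT]
    by (rule adjoint_map_eqI[OF dual_BT[OF k]])
      (use F G cl in \<open>auto simp: pairs add odd simp del: lact.simps ract.simps mixl.simps mixr.simps mixl_odd.simps mixr_odd.simps\<close>)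
qed

lemma bowtie_act:
  assumes "2*k \<le> m" and a: "a \<in> carrier A" and x: "x \<in> carrier X"
    and "F \<in> carrier (level P (2*k))" "G \<in> carrier (level Q (2*k))"
  shows "lact BT RB (2*k) (a, x) (F, G) =
        (lact P RA (2*k) a F,
         mixl P Q M k x F \<oplus>\<^bsub>level Q (2*k)\<^esub> lact Q M (2*k) a G \<oplus>\<^bsub>level Q (2*k)\<^esub> lact Q RX (2*k) x G)"
    and "ract BT RB (2*k) (F, G) (a, x) =
        (ract P RA (2*k) F a,
         mixr P Q M k F x \<oplus>\<^bsub>level Q (2*k)\<^esub> ract Q M (2*k) G a \<oplus>\<^bsub>level Q (2*k)\<^esub> ract Q RX (2*k) G x)"
proof -
  have "lact BT RB (2*k) (a, x) (F, G) =
        (lact P RA (2*k) a F,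
         mixl P Q M k x F \<oplus>\<^bsub>level Q (2*k)\<^esub> lact Q M (2*k) a G \<oplus>\<^bsub>level Q (2*k)\<^esub> lact Q RX (2*k) x G) \<and>
      ract BT RB (2*k) (F, G) (a, x) =
        (ract P RA (2*k) F a,
         mixr P Q M k F x \<oplus>\<^bsub>level Q (2*k)\<^esub> ract Q M (2*k) G a \<oplus>\<^bsub>level Q (2*k)\<^esub> ract Q RX (2*k) G x)"
    using assms(1,4,5)
  proof (induction k arbitrary: F G)
    case 0
    interpret X: abelian_group X by (rule normed_space_abelian_group[OF normed_base(2)])
    have "left M a G \<in> carrier X" "right M x F \<in> carrier X"
      using 0 a x bimodules(1)
        banach_bimodule_bounded_linear[OF bimodules(1), THEN bounded_linear_mapD(1)] by simp_all
    \<comment> \<open>The product of the algebra lists aG before xF, the asserted formula the other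
      way round; commutativity repairs this for the left action.\<close>
    then show ?case
      by (simp add: regular_bimodule_def bowtie_def X.a_comm)
  next
    case (Suc k)
    then have k: "Suc (2*k) < m" "2*k < m" "2*k \<le> m" by auto
    show ?case
      using bowtie_act_Suc_of_odd[OF k(1) a x] bowtie_act_odd_of_even[OF k(2) a x] Suc.IH[OF k(3)]
        Suc.prems
      by (simp del: lact.simps ract.simps mixl.simps mixr.simps mixl_odd.simps mixr_odd.simps)
  qed
  then show "lact BT RB (2*k) (a, x) (F, G) =
        (lact P RA (2*k) a F,
         mixl P Q M k x F \<oplus>\<^bsub>level Q (2*k)\<^esub> lact Q M (2*k) a G \<oplus>\<^bsub>level Q (2*k)\<^esub> lact Q RX (2*k) x G)"
    "ract BT RB (2*k) (F, G) (a, x) =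
        (ract P RA (2*k) F a,
         mixr P Q M k F x \<oplus>\<^bsub>level Q (2*k)\<^esub> ract Q M (2*k) G a \<oplus>\<^bsub>level Q (2*k)\<^esub> ract Q RX (2*k) G x)"
    by auto
qed

section \<open>Restriction of actions, products and bounded maps to the summands A and X\<close>

lemma base_zero_closed: "\<zero>\<^bsub>A\<^esub> \<in> carrier A" "\<zero>\<^bsub>X\<^esub> \<in> carrier X"
proof -
  interpret A: abelian_group A by (rule normed_space_abelian_group[OF normed_base(1)])
  interpret X: abelian_group X by (rule normed_space_abelian_group[OF normed_base(2)])
  show "\<zero>\<^bsub>A\<^esub> \<in> carrier A" "\<zero>\<^bsub>X\<^esub> \<in> carrier X" by simp_all
qed

lemma bowtie_act_fst:
  assumes k: "2*k \<le> m" and a: "a \<in> carrier A"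
    and F: "F \<in> carrier (level P (2*k))" and G: "G \<in> carrier (level Q (2*k))"
  shows "lact BT RB (2*k) (a, \<zero>\<^bsub>X\<^esub>) (F, G) = (lact P RA (2*k) a F, lact Q M (2*k) a G)"
    and "ract BT RB (2*k) (F, G) (a, \<zero>\<^bsub>X\<^esub>) = (ract P RA (2*k) F a, ract Q M (2*k) G a)"
proof -
  interpret Q: abelian_group "level Q (2*k)" by (rule group_Q[OF k])
  show "lact BT RB (2*k) (a, \<zero>\<^bsub>X\<^esub>) (F, G) = (lact P RA (2*k) a F, lact Q M (2*k) a G)"
    "ract BT RB (2*k) (F, G) (a, \<zero>\<^bsub>X\<^esub>) = (ract P RA (2*k) F a, ract Q M (2*k) G a)"
    using act_M[OF a k, THEN bounded_linear_mapD(1), OF G]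
    by (simp_all add: bowtie_act[OF k a base_zero_closed(2) F G] mix_zero[OF k F] act_X_zero[OF k G])
qed

text \<open>The first component of the action involves a alone, so it dies for a = 0, while F
  survives through the mixed product.\<close>

lemma bowtie_act_snd:
  assumes k: "2*k \<le> m" and x: "x \<in> carrier X"
    and F: "F \<in> carrier (level P (2*k))" and G: "G \<in> carrier (level Q (2*k))"
  shows "lact BT RB (2*k) (\<zero>\<^bsub>A\<^esub>, x) (F, G) =
      (\<zero>\<^bsub>level P (2*k)\<^esub>, mixl P Q M k x F \<oplus>\<^bsub>level Q (2*k)\<^esub> lact Q RX (2*k) x G)"
    and "ract BT RB (2*k) (F, G) (\<zero>\<^bsub>A\<^esub>, x) =
      (\<zero>\<^bsub>level P (2*k)\<^esub>, mixr P Q M k F x \<oplus>\<^bsub>level Q (2*k)\<^esub> ract Q RX (2*k) G x)"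
proof -
  interpret Q: abelian_group "level Q (2*k)" by (rule group_Q[OF k])
  show "lact BT RB (2*k) (\<zero>\<^bsub>A\<^esub>, x) (F, G) =
      (\<zero>\<^bsub>level P (2*k)\<^esub>, mixl P Q M k x F \<oplus>\<^bsub>level Q (2*k)\<^esub> lact Q RX (2*k) x G)"
    "ract BT RB (2*k) (F, G) (\<zero>\<^bsub>A\<^esub>, x) =
      (\<zero>\<^bsub>level P (2*k)\<^esub>, mixr P Q M k F x \<oplus>\<^bsub>level Q (2*k)\<^esub> ract Q RX (2*k) G x)"
    using bounded_linear_mix[OF x k, THEN bounded_linear_mapD(1), OF F]
    by (simp_all add: bowtie_act[OF k base_zero_closed(1) x F G] act_A_zero[OF k F] act_M_zero[OF k G])
qed

text \<open>A is a subalgebra and X an ideal of the product algebra, so each of these products stays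
  in a single summand.\<close>

lemma bowtie_mult:
  assumes "a \<in> carrier A" "b \<in> carrier A" "x \<in> carrier X" "y \<in> carrier X"
  shows "(a, \<zero>\<^bsub>X\<^esub>) \<otimes>\<^bsub>bowtie A X M\<^esub> (b, \<zero>\<^bsub>X\<^esub>) = (a \<otimes>\<^bsub>A\<^esub> b, \<zero>\<^bsub>X\<^esub>)"
    and "(a, \<zero>\<^bsub>X\<^esub>) \<otimes>\<^bsub>bowtie A X M\<^esub> (\<zero>\<^bsub>A\<^esub>, x) = (\<zero>\<^bsub>A\<^esub>, left M a x)"
    and "(\<zero>\<^bsub>A\<^esub>, x) \<otimes>\<^bsub>bowtie A X M\<^esub> (a, \<zero>\<^bsub>X\<^esub>) = (\<zero>\<^bsub>A\<^esub>, right M x a)"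
    and "(\<zero>\<^bsub>A\<^esub>, x) \<otimes>\<^bsub>bowtie A X M\<^esub> (\<zero>\<^bsub>A\<^esub>, y) = (\<zero>\<^bsub>A\<^esub>, x \<otimes>\<^bsub>X\<^esub> y)"
proof -
  interpret A: abelian_group A by (rule normed_space_abelian_group[OF normed_base(1)])
  interpret X: abelian_group X by (rule normed_space_abelian_group[OF normed_base(2)])
  have bounded: "bounded_linear_map X X (left M a)" "bounded_linear_map X X (\<lambda>x. right M x a)"
    "bounded_linear_map X X (\<lambda>y. x \<otimes>\<^bsub>X\<^esub> y)" "bounded_linear_map A A (\<lambda>b. a \<otimes>\<^bsub>A\<^esub> b)"
    if "a \<in> carrier A" "x \<in> carrier X" for a x
    using that banach_bimodule_bounded_linear[OF bimodules(1)] banach_bimodule_bounded_linear[OF bimodules(2)]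
      banach_bimodule_bounded_linear[OF bimodules(3)] by (simp_all add: regular_bimodule_def)
  have closed: "left M a x \<in> carrier X" "right M x a \<in> carrier X" "x \<otimes>\<^bsub>X\<^esub> y \<in> carrier X"
    if "a \<in> carrier A" "x \<in> carrier X" "y \<in> carrier X" for a x y
    using that bounded[THEN bounded_linear_mapD(1)] by auto
  have zero: "\<zero>\<^bsub>A\<^esub> \<otimes>\<^bsub>A\<^esub> a = \<zero>\<^bsub>A\<^esub>" "a \<otimes>\<^bsub>A\<^esub> \<zero>\<^bsub>A\<^esub> = \<zero>\<^bsub>A\<^esub>" "\<zero>\<^bsub>X\<^esub> \<otimes>\<^bsub>X\<^esub> x = \<zero>\<^bsub>X\<^esub>" "x \<otimes>\<^bsub>X\<^esub> \<zero>\<^bsub>X\<^esub> = \<zero>\<^bsub>X\<^esub>"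
    "left M \<zero>\<^bsub>A\<^esub> x = \<zero>\<^bsub>X\<^esub>" "right M x \<zero>\<^bsub>A\<^esub> = \<zero>\<^bsub>X\<^esub>"
    if "a \<in> carrier A" "x \<in> carrier X" for a x
    using that banach_bimodule_zero[OF bimodules(1)] banach_bimodule_zero[OF bimodules(2)]
      banach_bimodule_zero[OF bimodules(3)] by (simp_all add: regular_bimodule_def)
  have "left M a \<zero>\<^bsub>X\<^esub> = \<zero>\<^bsub>X\<^esub>" "right M \<zero>\<^bsub>X\<^esub> a = \<zero>\<^bsub>X\<^esub>" if "a \<in> carrier A" for a
    using that bounded[OF that X.zero_closed] linear_map_zero[OF normed_base(2) normed_base(2)]
    by (auto simp: bounded_linear_map_def)
  then show "(a, \<zero>\<^bsub>X\<^esub>) \<otimes>\<^bsub>bowtie A X M\<^esub> (b, \<zero>\<^bsub>X\<^esub>) = (a \<otimes>\<^bsub>A\<^esub> b, \<zero>\<^bsub>X\<^esub>)"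
    "(a, \<zero>\<^bsub>X\<^esub>) \<otimes>\<^bsub>bowtie A X M\<^esub> (\<zero>\<^bsub>A\<^esub>, x) = (\<zero>\<^bsub>A\<^esub>, left M a x)"
    "(\<zero>\<^bsub>A\<^esub>, x) \<otimes>\<^bsub>bowtie A X M\<^esub> (a, \<zero>\<^bsub>X\<^esub>) = (\<zero>\<^bsub>A\<^esub>, right M x a)"
    "(\<zero>\<^bsub>A\<^esub>, x) \<otimes>\<^bsub>bowtie A X M\<^esub> (\<zero>\<^bsub>A\<^esub>, y) = (\<zero>\<^bsub>A\<^esub>, x \<otimes>\<^bsub>X\<^esub> y)"
    using assms by (simp_all add: bowtie_def zero closed)
qed

text \<open>At even levels the norm of a pair is the sum of the norms, so it dominates each
  component; (a, 0) and (0, x) have the norms of a and x. The bound of D thus passes unchanged to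
  all four maps.\<close>

lemma bowtie_bounded_linear_components:
  assumes k: "even k" "k \<le> m" and D: "bounded_linear_map (bowtie A X M) (level BT k) D"
  shows "bounded_linear_map A (level P k) (\<lambda>a. fst (D (a, \<zero>\<^bsub>X\<^esub>)))"
    and "bounded_linear_map A (level Q k) (\<lambda>a. snd (D (a, \<zero>\<^bsub>X\<^esub>)))"
    and "bounded_linear_map X (level P k) (\<lambda>x. fst (D (\<zero>\<^bsub>A\<^esub>, x)))"
    and "bounded_linear_map X (level Q k) (\<lambda>x. snd (D (\<zero>\<^bsub>A\<^esub>, x)))"
proof -
  interpret A: module "scalar_ring :: 'k ring" A using normed_base by (simp add: normed_space_def)
  interpret X: module "scalar_ring :: 'k ring" X using normed_base by (simp add: normed_space_def)
  have zero: "nrm A \<zero>\<^bsub>A\<^esub> = 0" "nrm X \<zero>\<^bsub>X\<^esub> = 0"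
    using normed_base by (simp_all add: normed_space_def)
  have smult: "c \<odot>\<^bsub>A\<^esub> \<zero>\<^bsub>A\<^esub> = \<zero>\<^bsub>A\<^esub>" "c \<odot>\<^bsub>X\<^esub> \<zero>\<^bsub>X\<^esub> = \<zero>\<^bsub>X\<^esub>" for c
    using A.smult_r_null[of c] X.smult_r_null[of c] by simp_all
  have closed: "D (a, x) \<in> carrier (level P k) \<times> carrier (level Q k)"
    if "a \<in> carrier A" "x \<in> carrier X" for a x
    using bounded_linear_mapD(1)[OF D, of "(a, x)"] that by simp
  have add: "fst (D (a \<oplus>\<^bsub>A\<^esub> b, x \<oplus>\<^bsub>X\<^esub> y)) = fst (D (a, x)) \<oplus>\<^bsub>level P k\<^esub> fst (D (b, y))"
    "snd (D (a \<oplus>\<^bsub>A\<^esub> b, x \<oplus>\<^bsub>X\<^esub> y)) = snd (D (a, x)) \<oplus>\<^bsub>level Q k\<^esub> snd (D (b, y))"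
    if "a \<in> carrier A" "x \<in> carrier X" "b \<in> carrier A" "y \<in> carrier X" for a x b y
    using bounded_linear_mapD(2)[OF D, of "(a, x)" "(b, y)"] that
    by (cases "D (a, x)"; cases "D (b, y)"; simp)+
  have hom: "fst (D (c \<odot>\<^bsub>A\<^esub> a, c \<odot>\<^bsub>X\<^esub> x)) = c \<odot>\<^bsub>level P k\<^esub> fst (D (a, x))"
    "snd (D (c \<odot>\<^bsub>A\<^esub> a, c \<odot>\<^bsub>X\<^esub> x)) = c \<odot>\<^bsub>level Q k\<^esub> snd (D (a, x))"
    if "a \<in> carrier A" "x \<in> carrier X" for c a x
    using bounded_linear_mapD(3)[OF D, of "(a, x)" c] that by (cases "D (a, x)"; simp)+
  obtain K where K: "\<And>z. z \<in> carrier (bowtie A X M) \<Longrightarrow> nrm (level BT k) (D z) \<le> K * nrm (bowtie A X M) z"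
    using D unfolding bounded_linear_map_def by blast
  have bound: "nrm (level P k) (fst (D (a, x))) \<le> K * (nrm A a + nrm X x)"
    "nrm (level Q k) (snd (D (a, x))) \<le> K * (nrm A a + nrm X x)"
    if ax: "a \<in> carrier A" "x \<in> carrier X" for a x
  proof -
    obtain F G where FG: "D (a, x) = (F, G)" "F \<in> carrier (level P k)" "G \<in> carrier (level Q k)"
      using closed[OF ax] by (cases "D (a, x)") auto
    have "0 \<le> nrm (level P k) F" "0 \<le> nrm (level Q k) G"
      using FG normed_P[OF k(2)] normed_Q[OF k(2)] by (simp_all add: normed_space_def)
    then show "nrm (level P k) (fst (D (a, x))) \<le> K * (nrm A a + nrm X x)"
      "nrm (level Q k) (snd (D (a, x))) \<le> K * (nrm A a + nrm X x)"
      using K[of "(a, x)"] ax FG k by simp_all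
  qed
  have z: "\<zero>\<^bsub>A\<^esub> \<oplus>\<^bsub>A\<^esub> \<zero>\<^bsub>A\<^esub> = \<zero>\<^bsub>A\<^esub>" "\<zero>\<^bsub>X\<^esub> \<oplus>\<^bsub>X\<^esub> \<zero>\<^bsub>X\<^esub> = \<zero>\<^bsub>X\<^esub>" by simp_all
  note A0 = A.zero_closed and X0 = X.zero_closed
  note c1 = closed[OF _ X0] and c2 = closed[OF A0]
  note a1 = add[OF _ X0 _ X0, unfolded z] and a2 = add[OF A0 _ A0, unfolded z]
  note h1 = hom[OF _ X0, unfolded smult] and h2 = hom[OF A0, unfolded smult]
  note b1 = bound[OF _ X0, unfolded zero add_0_right] and b2 = bound[OF A0, unfolded zero add_0]
  show "bounded_linear_map A (level P k) (\<lambda>a. fst (D (a, \<zero>\<^bsub>X\<^esub>)))"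
    "bounded_linear_map A (level Q k) (\<lambda>a. snd (D (a, \<zero>\<^bsub>X\<^esub>)))"
    unfolding bounded_linear_map_def linear_map_def using c1 a1 h1 b1
    by (auto intro!: exI[of _ K] simp: mem_Times_iff)
  show "bounded_linear_map X (level P k) (\<lambda>x. fst (D (\<zero>\<^bsub>A\<^esub>, x)))"
    "bounded_linear_map X (level Q k) (\<lambda>x. snd (D (\<zero>\<^bsub>A\<^esub>, x)))"
    unfolding bounded_linear_map_def linear_map_def using c2 a2 h2 b2
    by (auto intro!: exI[of _ K] simp: mem_Times_iff)
qed

end

theorem lemma3p1:
  fixes A :: "('k :: {real_normed_field, banach}, 'a) nspace"
    and X :: "('k, 'x) nspace"
    and M :: "('k, 'a, 'x) bimodule"
    and n :: nat
    and P :: "('k, 'a) tower" and Q :: "('k, 'x) tower"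
    and D :: "'a \<times> 'x \<Rightarrow> 'a \<times> 'x"
  assumes "algebraic_banach_module A X M"
    and "dual_tower (2*n) A P"
    and "dual_tower (2*n) X Q"
    and "derivation (bowtie A X M)
           (dual_bimodule (bowtie_tower P Q M) (regular_bimodule (bowtie A X M)) (2*n)) D"
  shows "
    let AX = bowtie A X M;
        A2n = level P (2*n);
        X2n = level Q (2*n);
        A_A2n = dual_bimodule P (regular_bimodule A) (2*n);
        A_X2n = dual_bimodule Q M (2*n);
        X_X2n = dual_bimodule Q (regular_bimodule X) (2*n);
        AX_AX2n = dual_bimodule (bowtie_tower P Q M) (regular_bimodule AX) (2*n);
        xF = mixl P Q M n;
        Fx = mixr P Q M n
    in \<exists>D\<^sub>A D\<^sub>X T\<^sub>A T\<^sub>X.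
      (\<forall>a\<in>carrier A. \<forall>x\<in>carrier X.
         D (a, x) = (D\<^sub>A a \<oplus>\<^bsub>A2n\<^esub> T\<^sub>A x, D\<^sub>X a \<oplus>\<^bsub>X2n\<^esub> T\<^sub>X x)) \<and>
      derivation A A_A2n D\<^sub>A \<and>
      derivation A A_X2n D\<^sub>X \<and>
      bounded_bimodule_hom A M A_A2n T\<^sub>A \<and>
      (\<forall>x\<in>carrier X. \<forall>y\<in>carrier X. T\<^sub>A (x \<otimes>\<^bsub>X\<^esub> y) = \<zero>\<^bsub>A2n\<^esub>) \<and>
      bounded_linear_map X X2n T\<^sub>X \<and>
      (\<forall>a\<in>carrier A. \<forall>x\<in>carrier X.
         T\<^sub>X (left M a x) =
           Fx (D\<^sub>A a) x \<oplus>\<^bsub>X2n\<^esub> right X_X2n (D\<^sub>X a) x \<oplus>\<^bsub>X2n\<^esub> left A_X2n a (T\<^sub>X x)) \<and>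
      (\<forall>a\<in>carrier A. \<forall>x\<in>carrier X.
         T\<^sub>X (right M x a) =
           xF x (D\<^sub>A a) \<oplus>\<^bsub>X2n\<^esub> left X_X2n x (D\<^sub>X a) \<oplus>\<^bsub>X2n\<^esub> right A_X2n (T\<^sub>X x) a) \<and>
      (\<forall>x\<in>carrier X. \<forall>y\<in>carrier X.
         T\<^sub>X (x \<otimes>\<^bsub>X\<^esub> y) =
           left X_X2n x (T\<^sub>X y) \<oplus>\<^bsub>X2n\<^esub> right X_X2n (T\<^sub>X x) y
           \<oplus>\<^bsub>X2n\<^esub> xF x (T\<^sub>A y) \<oplus>\<^bsub>X2n\<^esub> Fx (T\<^sub>A x) y) \<and>
      (\<forall>F\<in>carrier A2n. \<forall>G\<in>carrier X2n.
         (\<forall>b\<in>carrier AX. D b = inner_derivation AX_AX2n (F, G) b) \<longleftrightarrow>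
         (\<forall>a\<in>carrier A. D\<^sub>A a = inner_derivation A_A2n F a) \<and>
         (\<forall>a\<in>carrier A. D\<^sub>X a = inner_derivation A_X2n G a) \<and>
         (\<forall>x\<in>carrier X. T\<^sub>X x =
            inner_derivation X_X2n G x \<oplus>\<^bsub>X2n\<^esub> (xF x F \<ominus>\<^bsub>X2n\<^esub> Fx F x)) \<and>
         (\<forall>x\<in>carrier X. T\<^sub>A x = \<zero>\<^bsub>A2n\<^esub>))"
proof -
  interpret bowtie_duals A X M P Q "2*n"
    using assms by unfold_locales
  let ?P = "level P (2*n)" and ?Q = "level Q (2*n)"
  interpret A: abelian_group A by (rule normed_space_abelian_group[OF normed_base(1)])
  interpret X: abelian_group X by (rule normed_space_abelian_group[OF normed_base(2)])
  interpret P: abelian_group ?P by (rule group_P) simp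
  interpret Q: abelian_group ?Q by (rule group_Q) simp
  \<comment> \<open>The choice is forced: linear components vanish at 0, so D on (a, 0) and (0, x)
    must return exactly these values.\<close>
  define DA DX TA TX where
    "DA = (\<lambda>a. fst (D (a, \<zero>\<^bsub>X\<^esub>)))" and "DX = (\<lambda>a. snd (D (a, \<zero>\<^bsub>X\<^esub>)))" and
    "TA = (\<lambda>x. fst (D (\<zero>\<^bsub>A\<^esub>, x)))" and "TX = (\<lambda>x. snd (D (\<zero>\<^bsub>A\<^esub>, x)))"
  have D: "bounded_linear_map (bowtie A X M) (level BT (2*n)) D"
    using assms(4) by (simp add: derivation_def dual_bimodule_def)
  have leibniz: "D (z \<otimes>\<^bsub>bowtie A X M\<^esub> w) =
      ract BT RB (2*n) (D z) w \<oplus>\<^bsub>level BT (2*n)\<^esub> lact BT RB (2*n) z (D w)"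
    if "z \<in> carrier (bowtie A X M)" "w \<in> carrier (bowtie A X M)" for z w
    using assms(4) that by (cases z; cases w) (simp add: derivation_def dual_bimodule_def)
  have comp: "bounded_linear_map A ?P DA" "bounded_linear_map A ?Q DX"
    "bounded_linear_map X ?P TA" "bounded_linear_map X ?Q TX"
    using bowtie_bounded_linear_components[OF _ _ D] by (simp_all add: DA_def DX_def TA_def TX_def)
  note closed [simp] = comp[THEN bounded_linear_mapD(1)]
  have D_fst: "D (a, \<zero>\<^bsub>X\<^esub>) = (DA a, DX a)" and D_snd: "D (\<zero>\<^bsub>A\<^esub>, x) = (TA x, TX x)" for a x
    by (simp_all add: DA_def DX_def TA_def TX_def)
  have D_eq: "D (a, x) = (DA a \<oplus>\<^bsub>?P\<^esub> TA x, DX a \<oplus>\<^bsub>?Q\<^esub> TX x)"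
    if "a \<in> carrier A" "x \<in> carrier X" for a x
    using bounded_linear_mapD(2)[OF D, of "(a, \<zero>\<^bsub>X\<^esub>)" "(\<zero>\<^bsub>A\<^esub>, x)"] that
    by (simp add: D_fst D_snd)
  have act [simp]:
    "a \<in> carrier A \<Longrightarrow> F \<in> carrier ?P \<Longrightarrow> lact P RA (2*n) a F \<in> carrier ?P"
    "a \<in> carrier A \<Longrightarrow> F \<in> carrier ?P \<Longrightarrow> ract P RA (2*n) F a \<in> carrier ?P"
    "a \<in> carrier A \<Longrightarrow> G \<in> carrier ?Q \<Longrightarrow> lact Q M (2*n) a G \<in> carrier ?Q"
    "a \<in> carrier A \<Longrightarrow> G \<in> carrier ?Q \<Longrightarrow> ract Q M (2*n) G a \<in> carrier ?Q"
    "x \<in> carrier X \<Longrightarrow> G \<in> carrier ?Q \<Longrightarrow> lact Q RX (2*n) x G \<in> carrier ?Q"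
    "x \<in> carrier X \<Longrightarrow> G \<in> carrier ?Q \<Longrightarrow> ract Q RX (2*n) G x \<in> carrier ?Q"
    "x \<in> carrier X \<Longrightarrow> F \<in> carrier ?P \<Longrightarrow> mixl P Q M n x F \<in> carrier ?Q"
    "x \<in> carrier X \<Longrightarrow> F \<in> carrier ?P \<Longrightarrow> mixr P Q M n F x \<in> carrier ?Q"
    for a x F G
    using act_A[THEN bounded_linear_mapD(1)] act_M[THEN bounded_linear_mapD(1)]
      act_X[THEN bounded_linear_mapD(1)] bounded_linear_mix[THEN bounded_linear_mapD(1)]
    by auto
  note acts = bowtie_act_fst[OF order_refl] bowtie_act_snd[OF order_refl]
  have AA: "DA (a \<otimes>\<^bsub>A\<^esub> b) = ract P RA (2*n) (DA a) b \<oplus>\<^bsub>?P\<^esub> lact P RA (2*n) a (DA b)"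
    "DX (a \<otimes>\<^bsub>A\<^esub> b) = ract Q M (2*n) (DX a) b \<oplus>\<^bsub>?Q\<^esub> lact Q M (2*n) a (DX b)"
    if "a \<in> carrier A" "b \<in> carrier A" for a b
    \<comment> \<open>The four product rules share their hypotheses, so an argument that does not
      occur in the chosen rule is filled by any element of the right carrier.\<close>
    using leibniz[of "(a, \<zero>\<^bsub>X\<^esub>)" "(b, \<zero>\<^bsub>X\<^esub>)"] that bowtie_mult(1)[of a b "\<zero>\<^bsub>X\<^esub>" "\<zero>\<^bsub>X\<^esub>"]
    by (simp_all add: D_fst acts)
  \<comment> \<open>In D(a, 0)(0, x) the first component is zero, so the first coordinate retains
    only a TA(x); the second picks up the mixed term DA(a)x.\<close>
  have AX: "TA (left M a x) = lact P RA (2*n) a (TA x)"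
    "TX (left M a x) = mixr P Q M n (DA a) x \<oplus>\<^bsub>?Q\<^esub> ract Q RX (2*n) (DX a) x \<oplus>\<^bsub>?Q\<^esub> lact Q M (2*n) a (TX x)"
    if "a \<in> carrier A" "x \<in> carrier X" for a x
    using leibniz[of "(a, \<zero>\<^bsub>X\<^esub>)" "(\<zero>\<^bsub>A\<^esub>, x)"] that bowtie_mult(2)[of a a x x]
    by (simp_all add: D_fst D_snd acts)
  have XA: "TA (right M x a) = ract P RA (2*n) (TA x) a"
    "TX (right M x a) = mixl P Q M n x (DA a) \<oplus>\<^bsub>?Q\<^esub> lact Q RX (2*n) x (DX a) \<oplus>\<^bsub>?Q\<^esub> ract Q M (2*n) (TX x) a"
    if "a \<in> carrier A" "x \<in> carrier X" for a x
    using leibniz[of "(\<zero>\<^bsub>A\<^esub>, x)" "(a, \<zero>\<^bsub>X\<^esub>)"] that bowtie_mult(3)[of a a x x]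
    by (simp_all add: D_fst D_snd acts Q.a_ac)
  \<comment> \<open>Both terms of the product rule now carry an action of some (0, z), so the first
    coordinate is zero, and \<open>TA\<close> enters the second only through mixed products.\<close>
  have XX: "TA (x \<otimes>\<^bsub>X\<^esub> y) = \<zero>\<^bsub>?P\<^esub>"
    "TX (x \<otimes>\<^bsub>X\<^esub> y) = lact Q RX (2*n) x (TX y) \<oplus>\<^bsub>?Q\<^esub> ract Q RX (2*n) (TX x) y
      \<oplus>\<^bsub>?Q\<^esub> mixl P Q M n x (TA y) \<oplus>\<^bsub>?Q\<^esub> mixr P Q M n (TA x) y"
    if "x \<in> carrier X" "y \<in> carrier X" for x y
    using leibniz[of "(\<zero>\<^bsub>A\<^esub>, x)" "(\<zero>\<^bsub>A\<^esub>, y)"] that bowtie_mult(4)[of "\<zero>\<^bsub>A\<^esub>" "\<zero>\<^bsub>A\<^esub>" x y]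
    by (simp_all add: D_snd acts Q.a_ac)
  \<comment> \<open>The four components are fixed before F and G, and the equivalence holds for each
    pair (F, G); the version with "for some F, G" on both sides is a consequence.\<close>
  have inner: "(\<forall>b\<in>carrier (bowtie A X M).
        D b = inner_derivation (dual_bimodule BT RB (2*n)) (F, G) b) \<longleftrightarrow>
      (\<forall>a\<in>carrier A. DA a = inner_derivation (dual_bimodule P RA (2*n)) F a) \<and>
      (\<forall>a\<in>carrier A. DX a = inner_derivation (dual_bimodule Q M (2*n)) G a) \<and>
      (\<forall>x\<in>carrier X. TX x = inner_derivation (dual_bimodule Q RX (2*n)) G x \<oplus>\<^bsub>?Q\<^esub>
        (mixl P Q M n x F \<ominus>\<^bsub>?Q\<^esub> mixr P Q M n F x)) \<and>
      (\<forall>x\<in>carrier X. TA x = \<zero>\<^bsub>?P\<^esub>)" (is "?L \<longleftrightarrow> ?R")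
    if F: "F \<in> carrier ?P" and G: "G \<in> carrier ?Q" for F G
  proof
    assume L: ?L
    have "(DA a, DX a) = (lact P RA (2*n) a F \<ominus>\<^bsub>?P\<^esub> ract P RA (2*n) F a,
        lact Q M (2*n) a G \<ominus>\<^bsub>?Q\<^esub> ract Q M (2*n) G a)" if "a \<in> carrier A" for a
      using L[rule_format, of "(a, \<zero>\<^bsub>X\<^esub>)"] that F G
      by (simp add: inner_derivation_def dual_bimodule_def D_fst acts bowtie_minus)
    \<comment> \<open>The first coordinate is a difference of two zeros, since (0, x) acts with zero
      first component on either side. Regrouping the second turns it into \<open>d_G\<close> plus
      \<delta> of F.\<close>
    moreover have "(TA x, TX x) = (\<zero>\<^bsub>?P\<^esub> \<ominus>\<^bsub>?P\<^esub> \<zero>\<^bsub>?P\<^esub>,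
        (mixl P Q M n x F \<oplus>\<^bsub>?Q\<^esub> lact Q RX (2*n) x G) \<ominus>\<^bsub>?Q\<^esub>
        (mixr P Q M n F x \<oplus>\<^bsub>?Q\<^esub> ract Q RX (2*n) G x))" if "x \<in> carrier X" for x
      using L[rule_format, of "(\<zero>\<^bsub>A\<^esub>, x)"] that F G
      by (simp add: inner_derivation_def dual_bimodule_def D_snd acts bowtie_minus)
    ultimately show ?R
      using F G by (simp add: inner_derivation_def dual_bimodule_def Q.minus_eq P.minus_eq
          P.r_neg Q.minus_add Q.a_ac)
  next
    assume R: ?R
    show ?L
    proof
      fix b assume "b \<in> carrier (bowtie A X M)"
      then obtain a x where b: "b = (a, x)" "a \<in> carrier A" "x \<in> carrier X" by auto
      show "D b = inner_derivation (dual_bimodule BT RB (2*n)) (F, G) b"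
        \<comment> \<open>By \<open>D_eq\<close> the values on the two summands determine D. With
          \<open>TA\<close> zero the first coordinates agree, and the second ones differ only in the
          order of their terms.\<close>
        using b F G R by (simp add: D_eq bowtie_act inner_derivation_def dual_bimodule_def
            bowtie_minus Q.minus_eq P.minus_eq Q.minus_add Q.a_ac)
    qed
  qed
  show ?thesis
    unfolding Let_def using D_eq AA AX XA XX comp inner
    by - (rule exI[of _ DA], rule exI[of _ DX], rule exI[of _ TA], rule exI[of _ TX],
        simp add: derivation_def bounded_bimodule_hom_def dual_bimodule_def)
qed

end
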